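(* Let $S_0>0$ and $\tau>0$. For $\sigma_0>0$ and $T>0$ let $C(S_0,T)=C_{\sigma_0}(S_0,T)$ be the at-the-money call price with maturity $T$ in the uncorrelated log-normal SABR model with $\omega=1$ and initial volatility $\sigma_0$. Then $$\lim_{\sigma_0\to\infty}\frac{1}{\sigma_0}\log\left[S_0-C\left(S_0,\frac{2\tau}{\sigma_0}\right)\right]=-\frac14\,\hat\Sigma_{\rm BS}^2(\tau)\,\tau,$$ where $$\hat\Sigma_{\rm BS}^2(\tau)=\frac{\sin 2\lambda}{\lambda}-\frac12\left(1+\cos(2\lambda)\right)$$ and $\lambda=\lambda(\tau)\in(0,\frac{\pi}{2})$ is the solution of $\frac{\lambda}{\cos\lambda}=\tau$.
   Context: The uncorrelated log-normal ($\beta=1$) SABR model with $\omega=1$: $dS_t=\sigma_tS_t\,dW_t$, $d\sigma_t=\sigma_t\,dZ_t$, with $W,Z$ independent standard Brownian motions and deterministic initial values $S_0>0$, $\sigma_0>0$. The at-the-money call price is $C(S_0,T)=\mathbb{E}[(S_T-S_0)^+]$. It has the exact representation (known, taken as the starting point) $$C(S_0,T)=\frac{2S_0e^{-T/8}}{\pi^{3/2}\sqrt{T}}\int_0^\infty e^{-\frac{u^2}{2T}}g(u)\,du,\qquad g(u)=\sinh u\int_0^u\frac{1}{\sqrt{\cosh u-\cosh s}}\,\frac{\sin(\frac{\sigma_0}{2}\sinh s)}{\sinh s}\,ds\quad(u>0).$$ *)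

theory Defs
  imports "HOL-Probability.Probability"
begin

definition brownian_motion ::
  "'a measure \<Rightarrow> (real \<Rightarrow> 'a measure) \<Rightarrow> (real \<Rightarrow> 'a \<Rightarrow> real) \<Rightarrow> bool" where
  "brownian_motion M F W \<longleftrightarrow>
     (AE x in M. W 0 x = 0) \<and>
     (\<forall>x\<in>space M. continuous_on {0..} (\<lambda>t. W t x)) \<and>
     (\<forall>t\<ge>0. W t \<in> borel_measurable (F t)) \<and>
     (\<forall>s t. 0 \<le> s \<and> s < t \<longrightarrow>
        distributed M lborel (\<lambda>x. W t x - W s x) (normal_density 0 (sqrt (t - s))) \<and>
        prob_space.indep_set M (sets (F s))
          {(\<lambda>x. W t x - W s x) -` B \<inter> space M | B. B \<in> sets borel})"

text \<open>
  A list entry \<open>(a, b, \<xi>)\<close> stands for the process \<open>\<xi>\<close> on \<open>(a, b]\<close> and \<open>0\<close> elsewhere; a list stands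
  for the sum of its entries.
\<close>

definition elementary_process ::
  "(real \<Rightarrow> 'a measure) \<Rightarrow> (real \<times> real \<times> ('a \<Rightarrow> real)) list \<Rightarrow> bool" where
  "elementary_process F es \<longleftrightarrow>
     (\<forall>(a, b, \<xi>)\<in>set es. 0 \<le> a \<and> a \<le> b \<and> \<xi> \<in> borel_measurable (F a) \<and>
        (\<exists>B. \<forall>x\<in>space (F a). \<bar>\<xi> x\<bar> \<le> B))"

definition elementary_value ::
  "(real \<times> real \<times> ('a \<Rightarrow> real)) list \<Rightarrow> real \<Rightarrow> 'a \<Rightarrow> real" where
  "elementary_value es s x = (\<Sum>(a, b, \<xi>)\<leftarrow>es. \<xi> x * indicator {a<..b} s)"

definition elementary_integral ::
  "(real \<Rightarrow> 'a \<Rightarrow> real) \<Rightarrow> (real \<times> real \<times> ('a \<Rightarrow> real)) list \<Rightarrow> real \<Rightarrow> 'a \<Rightarrow> real" where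
  "elementary_integral W es t x = (\<Sum>(a, b, \<xi>)\<leftarrow>es. \<xi> x * (W (min b t) x - W (min a t) x))"

definition vanishes_in_prob :: "'a measure \<Rightarrow> (nat \<Rightarrow> 'a \<Rightarrow> ennreal) \<Rightarrow> bool" where
  "vanishes_in_prob M D \<longleftrightarrow>
     (\<forall>n. D n \<in> borel_measurable M) \<and>
     (\<forall>e>0. (\<lambda>n. measure M {x\<in>space M. ennreal e < D n x}) \<longlonglongrightarrow> 0)"

text \<open>
  \<open>has_ito_integral M F W H t I\<close> says that \<open>I\<close> is (a version of) the Ito integral of \<open>H\<close> against the
  \<open>F\<close>-Brownian motion \<open>W\<close> over \<open>[0, t]\<close>, for adapted \<open>H\<close> with almost surely square integrable paths.
\<close>

definition has_ito_integral ::
  "'a measure \<Rightarrow> (real \<Rightarrow> 'a measure) \<Rightarrow> (real \<Rightarrow> 'a \<Rightarrow> real) \<Rightarrow> (real \<Rightarrow> 'a \<Rightarrow> real) \<Rightarrow>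
   real \<Rightarrow> ('a \<Rightarrow> real) \<Rightarrow> bool" where
  "has_ito_integral M F W H t I \<longleftrightarrow>
     (\<exists>es. (\<forall>n. elementary_process F (es n)) \<and>
        vanishes_in_prob M
          (\<lambda>n x. \<integral>\<^sup>+s\<in>{0..t}. ennreal ((elementary_value (es n) s x - H s x)\<^sup>2) \<partial>lborel) \<and>
        vanishes_in_prob M (\<lambda>n x. ennreal \<bar>elementary_integral W (es n) t x - I x\<bar>))"

text \<open>
  Uncorrelated log-normal SABR model with \<open>\<omega> = 1\<close>: \<open>dS = \<sigma> S dW\<close>, \<open>d\<sigma> = \<sigma> dZ\<close>, \<open>S(0) = S0\<close>,
  \<open>\<sigma>(0) = \<sigma>0\<close>. The stochastic differential equations are in integral form.
\<close>

definition sabr_model ::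
  "'a measure \<Rightarrow> (real \<Rightarrow> 'a measure) \<Rightarrow> (real \<Rightarrow> 'a \<Rightarrow> real) \<Rightarrow> (real \<Rightarrow> 'a \<Rightarrow> real) \<Rightarrow>
   real \<Rightarrow> real \<Rightarrow> (real \<Rightarrow> 'a \<Rightarrow> real) \<Rightarrow> (real \<Rightarrow> 'a \<Rightarrow> real) \<Rightarrow> bool" where
  "sabr_model M F W Z S0 \<sigma>0 S \<sigma> \<longleftrightarrow>
     prob_space M \<and> filtration (space M) F \<and> (\<forall>t. subalgebra M (F t)) \<and>
     brownian_motion M F W \<and> brownian_motion M F Z \<and>
     prob_space.indep_var M
       (\<Pi>\<^sub>M t\<in>{0..}. borel) (\<lambda>x. \<lambda>t\<in>{0..}. W t x)
       (\<Pi>\<^sub>M t\<in>{0..}. borel) (\<lambda>x. \<lambda>t\<in>{0..}. Z t x) \<and>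
     (\<forall>t\<ge>0. S t \<in> borel_measurable (F t) \<and> \<sigma> t \<in> borel_measurable (F t)) \<and>
     (\<forall>x\<in>space M. continuous_on {0..} (\<lambda>t. S t x) \<and> continuous_on {0..} (\<lambda>t. \<sigma> t x)) \<and>
     (AE x in M. S 0 x = S0 \<and> \<sigma> 0 x = \<sigma>0) \<and>
     (\<forall>t\<ge>0. has_ito_integral M F W (\<lambda>s x. \<sigma> s x * S s x) t (\<lambda>x. S t x - S0)) \<and>
     (\<forall>t\<ge>0. has_ito_integral M F Z \<sigma> t (\<lambda>x. \<sigma> t x - \<sigma>0))"

definition call_price :: "'a measure \<Rightarrow> (real \<Rightarrow> 'a \<Rightarrow> real) \<Rightarrow> real \<Rightarrow> real \<Rightarrow> real" where
  "call_price M S K T = (\<integral>x. max (S T x - K) 0 \<partial>M)"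

text \<open>
  \<open>sabr_atm_formula S0 \<sigma>0 T\<close> is the known exact integral representation of the at-the-money price
  \<open>E[(S(T) - S0)\<^sup>+]\<close> in this model. Its integrands are absolutely integrable, the inner one with an
  integrable singularity at \<open>s = u\<close>.
\<close>

definition sabr_g :: "real \<Rightarrow> real \<Rightarrow> real" where
  "sabr_g \<sigma>0 u =
     sinh u * (LBINT s:{0<..<u}. 1 / sqrt (cosh u - cosh s) * (sin (\<sigma>0 / 2 * sinh s) / sinh s))"

definition sabr_atm_formula :: "real \<Rightarrow> real \<Rightarrow> real \<Rightarrow> real" where
  "sabr_atm_formula S0 \<sigma>0 T =
     2 * S0 * exp (- T / 8) / (pi powr (3 / 2) * sqrt T) *
     (LBINT u:{0<..}. exp (- u\<^sup>2 / (2 * T)) * sabr_g \<sigma>0 u)"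

definition sabr_lambda :: "real \<Rightarrow> real" where
  "sabr_lambda \<tau> = (THE l. 0 < l \<and> l < pi / 2 \<and> l / cos l = \<tau>)"

lemma sabr_lambda_ex1:
  fixes \<tau> :: real
  assumes "\<tau> > 0"
  shows "\<exists>!l. 0 < l \<and> l < pi / 2 \<and> l / cos l = \<tau>"
proof -
  have "\<exists>l\<ge>0. l \<le> pi / 2 \<and> l - \<tau> * cos l = 0"
    using assms by (intro IVT') (auto intro!: continuous_intros)
  then obtain l where l: "0 \<le> l" "l \<le> pi / 2" "l = \<tau> * cos l"
    by auto
  have "l \<noteq> 0" "l \<noteq> pi / 2"
    using l(3) assms by (metis cos_zero mult.right_neutral less_irrefl,
        metis cos_pi_half mult_zero_right pi_half_neq_zero)
  with l have l': "0 < l" "l < pi / 2" by auto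
  then have "cos l > 0" by (intro cos_gt_zero_pi) auto
  with l have sol: "l / cos l = \<tau>" by (simp add: field_simps)
  have strict: "a / cos a < b / cos b" if "0 < a" "a < b" "b < pi / 2" for a b :: real
  proof -
    have "cos b > 0" using that by (intro cos_gt_zero_pi) auto
    moreover have "cos b < cos a" using that by (intro cos_monotone_0_pi) auto
    ultimately show ?thesis using that by (intro frac_less) auto
  qed
  show ?thesis
  proof (rule ex1I[of _ l])
    fix m assume m: "0 < m \<and> m < pi / 2 \<and> m / cos m = \<tau>"
    show "m = l"
      using strict[of m l] strict[of l m] m l' sol by (cases m l rule: linorder_cases) auto
  qed (use l' sol in auto)
qed

definition Sigma_BS_hat_sq :: "real \<Rightarrow> real" where
  "Sigma_BS_hat_sq \<tau> =
     (let l = sabr_lambda \<tau> in sin (2 * l) / l - 1 / 2 * (1 + cos (2 * l)))"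

end

theory Submission
  imports Defs "HOL-Complex_Analysis.Complex_Analysis" "HOL-Real_Asymp.Real_Asymp"
begin

text \<open>
  Write \<open>\<rho> = \<sigma>0 / 2\<close>, \<open>T = \<tau> / \<rho>\<close>. The substitution \<open>u\<^sup>2 = s\<^sup>2 + t\<close> turns the Gaussian factor of the
  price into \<open>exp (- s\<^sup>2 / (2 T)) exp (- t / (2 T))\<close>, and the rest of the integrand into a function of
  \<open>s\<close> that is holomorphic and even in the strip \<open>\<bar>Im s\<bar> < \<pi> / 2\<close>, apart from the factor
  \<open>sin (\<rho> sinh s) / sinh s\<close>, which is the imaginary part of \<open>exp (\<i> \<rho> sinh s) / sinh s\<close>. For each \<open>t\<close>
  the \<open>s\<close>-contour is moved from the real axis to \<open>Im s = \<lambda>\<close>. The segment of the imaginary axis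
  has a real integral, hence contributes nothing to the imaginary part; the pole at \<open>0\<close> contributes exactly \<open>S0\<close> to the price
  after integration over \<open>t\<close>. Hence \<open>S0 - C\<close> is the integral over the shifted contour. Its exponent
  \<open>\<rho> (\<i> sinh s - s\<^sup>2 / (2 \<tau>))\<close> has a saddle point at \<open>s = \<i> \<lambda>\<close> precisely when \<open>\<lambda> / cos \<lambda> = \<tau>\<close>, and
  after the scaling \<open>s = \<i> \<lambda> + x / sqrt \<rho>\<close>, \<open>t = z / \<rho>\<close> dominated convergence gives the decay rate
  \<open>\<rho> (sin \<lambda> - \<lambda>\<^sup>2 / (2 \<tau>))\<close>.
\<close>

subsection \<open>The hyperbolic cosine as an entire function of the square\<close>

text \<open>For fixed \<open>u\<close> the inner integrand has its branch point \<open>s = u\<close>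
  at the end of the range of integration, so that contour cannot simply be lifted off the real axis.
  With \<open>t = u^2 - s^2\<close> fixed, the range becomes a half line and the radicand an
  increment, over the real step \<open>t\<close>, of the function v -> cosh (sqrt v). Since cosh is
  even, this function is entire (\<open>cosh_root\<close>), so no branch of \<open>u\<close> has to
  be chosen. The decisive estimate: at squares of points with |Im| \<le> l < pi/2 its derivative has
  real part at least cos l / 2, and adding \<open>t\<close> to such a square gives another one.
  Hence the radicand has positive real part, its principal root is holomorphic, and its modulus is
  at least a constant times sqrt t. The half-width pi/2 is where the cosine stays positive. No
  steepest descent curve is needed: on the horizontal line, Im (sinh s) = cosh (Re s) sin l \<ge>
  sin l, so the modulus is at most its exponential size at the saddle times an integrable function.
  The pole gives exactly \<open>S0\<close> because its \<open>t\<close>-integral is Gaussian: pi/2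
  times sqrt (pi T) exp (T/8) cancels the prefactor 2 exp (-T/8) / (pi^(3/2) sqrt T).\<close>

definition cosh_root :: "complex \<Rightarrow> complex" where
  "cosh_root v = (\<Sum>n. inverse (fact (2 * n)) * v ^ n)"

lemma cosh_root_sums: "(\<lambda>n. inverse (fact (2 * n)) * (w\<^sup>2) ^ n) sums cosh (w :: complex)"
proof -
  let ?f = "\<lambda>n. if even n then w ^ n /\<^sub>R fact n else 0"
  have "(\<lambda>n. ?f (2 * n)) sums cosh w \<longleftrightarrow> ?f sums cosh w"
  proof (rule sums_mono_reindex)
    show "?f n = 0" if "n \<notin> range ((*) 2)" for n
      using that by (auto elim!: evenE)
  qed (auto simp: strict_mono_def)
  then have "(\<lambda>n. ?f (2 * n)) sums cosh w"
    using cosh_converges by blast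
  moreover have "?f (2 * n) = inverse (fact (2 * n)) * (w\<^sup>2) ^ n" for n
    by (simp add: power_mult scaleR_conv_of_real)
  ultimately show ?thesis by simp
qed

lemma cosh_root_square: "cosh_root (w\<^sup>2) = cosh w"
  unfolding cosh_root_def using cosh_root_sums by (rule sums_unique[symmetric])

lemma cosh_root_summable: "summable (\<lambda>n. inverse (fact (2 * n)) * (v :: complex) ^ n)"
  using sums_summable[OF cosh_root_sums[of "csqrt v"]] by simp

lemma has_field_derivative_cosh_root:
  "(cosh_root has_field_derivative (\<Sum>n. diffs (\<lambda>n. inverse (fact (2 * n))) n * v ^ n)) (at v)"
  unfolding cosh_root_def [abs_def]
  by (rule termdiffs_strong_converges_everywhere) (rule cosh_root_summable)

lemma holomorphic_on_cosh_root [holomorphic_intros]: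
  "f holomorphic_on A \<Longrightarrow> (\<lambda>z. cosh_root (f z)) holomorphic_on A"
  using holomorphic_on_compose[of f A cosh_root, unfolded o_def]
    holomorphic_onI[of "f ` A" cosh_root] has_field_derivative_cosh_root
  by (meson field_differentiable_at_within field_differentiable_def)

lemma holomorphic_on_deriv_cosh_root [holomorphic_intros]:
  assumes "f holomorphic_on A"
  shows "(\<lambda>z. deriv cosh_root (f z)) holomorphic_on A"
proof -
  have "deriv cosh_root holomorphic_on UNIV"
    by (intro holomorphic_deriv holomorphic_on_cosh_root) (auto intro: holomorphic_intros)
  then show ?thesis
    using assms holomorphic_on_compose[of f A "deriv cosh_root", unfolded o_def]
    by (meson holomorphic_on_subset subset_UNIV)
qed

lemma DERIV_cosh_root: "(cosh_root has_field_derivative deriv cosh_root v) (at v)"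
  using has_field_derivative_cosh_root DERIV_imp_deriv by metis

lemma deriv_cosh_root_0: "deriv cosh_root 0 = 1 / 2"
  using DERIV_imp_deriv[OF has_field_derivative_cosh_root[of 0]]
    powser_zero[of "diffs (\<lambda>n. inverse (fact (2 * n)) :: complex)"]
  by (simp add: diffs_def fact_2)

text \<open>Chain rule for \<open>cosh_root (w\<^sup>2) = cosh w\<close>. The derivative is thus
  sinh w / (2 w), the kernel's numerator; the form without division also covers w = 0.\<close>

lemma deriv_cosh_root_square: "2 * w * deriv cosh_root (w\<^sup>2) = sinh w"
proof -
  have "((\<lambda>w. cosh_root (w\<^sup>2)) has_field_derivative deriv cosh_root (w\<^sup>2) * (2 * w)) (at w)"
    by (rule DERIV_chain2[OF DERIV_cosh_root]) (auto intro!: derivative_eq_intros)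
  moreover have "(cosh has_field_derivative sinh w) (at w)"
    by (auto intro!: derivative_eq_intros)
  ultimately have "deriv cosh_root (w\<^sup>2) * (2 * w) = sinh w"
    unfolding cosh_root_square by (rule DERIV_unique)
  then show ?thesis by (simp add: mult_ac)
qed

section \<open>Bounds for the derivative and the increments in the strip\<close>

lemma mult_cos_le_sin:
  fixes q l :: real
  assumes "0 \<le> q" "q \<le> l" "l \<le> pi"
  shows "q * cos l \<le> sin q"
proof (cases "q = 0")
  case False
  then obtain x where x: "0 < x" "x < q" "sin q - sin 0 = (q - 0) * cos x"
    using MVT2[of 0 q sin cos] assms by (auto intro!: derivative_eq_intros)
  moreover have "cos l \<le> cos x"
    using assms x by (intro cos_monotone_0_pi_le) auto
  ultimately show ?thesis
    using assms by (simp add: mult_left_mono)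
qed auto

lemma Re_sinh: "Re (sinh z) = sinh (Re z) * cos (Im z)"
  and Im_sinh: "Im (sinh z) = cosh (Re z) * sin (Im z)"
  by (simp_all add: sinh_def cosh_def Re_exp Im_exp field_simps)

lemma Re_cnj_mult_sinh:
  "Re (cnj w * sinh w) = Re w * sinh (Re w) * cos (Im w) + Im w * cosh (Re w) * sin (Im w)"
  by (simp add: Re_sinh Im_sinh algebra_simps)

lemma le_sinh:
  fixes p :: real
  assumes "0 \<le> p"
  shows "p \<le> sinh p"
proof (cases "p = 0")
  case False
  with assms have "\<exists>x>0. x < p \<and> sinh p - sinh 0 = (p - 0) * cosh x"
    by (intro MVT2) (auto intro!: derivative_eq_intros)
  then obtain x where "sinh p - sinh 0 = (p - 0) * cosh x" by blast
  moreover have "p * 1 \<le> p * cosh x"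
    using assms by (intro mult_left_mono cosh_real_ge_1)
  ultimately show ?thesis by simp
qed auto

text \<open>Multiplying sinh w = 2 w \<open>deriv cosh_root (w\<^sup>2)\<close> by the conjugate of
  w = p + iq turns the claim into a lower bound (p^2 + q^2) cos l for p sinh p cos q + q sin q cosh
  p. It holds term by term: |p| \<le> sinh |p| and cos l \<le> cos q for the first, |q| cos l \<le>
  sin |q| and 1 \<le> cosh p for the second.\<close>

lemma Re_deriv_cosh_root_square_ge:
  assumes "\<bar>Im w\<bar> \<le> l" "l < pi / 2"
  shows "Re (deriv cosh_root (w\<^sup>2)) \<ge> cos l / 2"
proof (cases "w = 0")
  case True
  then show ?thesis by (simp add: deriv_cosh_root_0)
next
  case False
  define p q where "p = Re w" and "q = Im w"
  have cl: "0 \<le> cos l" "cos l \<le> cos q"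
    using assms cos_monotone_0_pi_le[of "\<bar>q\<bar>" l] by (auto simp: q_def intro!: cos_ge_zero)
  have "\<bar>p\<bar> \<le> sinh \<bar>p\<bar>"
    by (rule le_sinh) simp
  then have "p\<^sup>2 \<le> p * sinh p"
    by (cases "p \<ge> 0") (auto simp: power2_eq_square mult_left_mono mult_left_mono_neg)
  then have 1: "p\<^sup>2 * cos l \<le> p * sinh p * cos q"
    using cl by (intro mult_mono) (auto intro: order_trans[of _ "p\<^sup>2"])
  have "\<bar>q\<bar> * cos l \<le> sin \<bar>q\<bar>"
    using assms by (intro mult_cos_le_sin) (auto simp: q_def)
  then have "\<bar>q\<bar> * (\<bar>q\<bar> * cos l) \<le> \<bar>q\<bar> * sin \<bar>q\<bar>"
    by (intro mult_left_mono) auto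
  then have 2: "q\<^sup>2 * cos l \<le> q * sin q"
    by (cases "q \<ge> 0") (auto simp: power2_eq_square)
  have "q * sin q * 1 \<le> q * sin q * cosh p"
    using 2 cl by (intro mult_left_mono cosh_real_ge_1)
        (meson order_trans mult_nonneg_nonneg zero_le_power2)
  with 1 2 have "(p\<^sup>2 + q\<^sup>2) * cos l \<le> Re (cnj w * sinh w)"
    unfolding Re_cnj_mult_sinh by (simp add: p_def q_def algebra_simps)
  also have "cnj w * sinh w = of_real (2 * (p\<^sup>2 + q\<^sup>2)) * deriv cosh_root (w\<^sup>2)"
    unfolding deriv_cosh_root_square[of w, symmetric] of_real_mult p_def q_def
      complex_mult_cnj[symmetric] by simp
  finally have "(p\<^sup>2 + q\<^sup>2) * cos l \<le> (p\<^sup>2 + q\<^sup>2) * (2 * Re (deriv cosh_root (w\<^sup>2)))"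
    by (simp add: algebra_simps)
  moreover have "p\<^sup>2 + q\<^sup>2 > 0"
    using False by (simp add: p_def q_def complex_eq_iff sum_power2_gt_zero_iff)
  ultimately show ?thesis
    by simp
qed

text \<open>For any z, 2 (Im z)^2 = |z^2| - Re (z^2). Adding \<open>t\<close> raises the real part
  of the square by exactly \<open>t\<close> and its modulus by at most \<open>t\<close>, so the root
  stays in the same strip.\<close>

lemma abs_Im_csqrt_add_le:
  assumes "t \<ge> 0"
  shows "\<bar>Im (csqrt (s\<^sup>2 + of_real t))\<bar> \<le> \<bar>Im s\<bar>"
proof -
  have norm: "(Re z)\<^sup>2 + (Im z)\<^sup>2 = cmod (z\<^sup>2)" for z
    by (simp add: norm_power cmod_power2)
  have Re: "(Re z)\<^sup>2 - (Im z)\<^sup>2 = Re (z\<^sup>2)" for z :: complex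
    by (simp add: power2_eq_square)
  have "2 * (Im (csqrt (s\<^sup>2 + of_real t)))\<^sup>2 = cmod (s\<^sup>2 + of_real t) - Re (s\<^sup>2 + of_real t)"
    using norm[of "csqrt (s\<^sup>2 + of_real t)"] Re[of "csqrt (s\<^sup>2 + of_real t)"] by simp
  also have "\<dots> \<le> cmod (s\<^sup>2) - Re (s\<^sup>2)"
    using norm_triangle_ineq[of "s\<^sup>2" "of_real t"] assms by simp
  also have "\<dots> = 2 * (Im s)\<^sup>2"
    using norm[of s] Re[of s] by simp
  finally show ?thesis by (simp add: abs_le_square_iff)
qed

lemma Re_deriv_cosh_root_ge:
  assumes "\<bar>Im s\<bar> \<le> l" "l < pi / 2" "t \<ge> 0"
  shows "Re (deriv cosh_root (s\<^sup>2 + of_real t)) \<ge> cos l / 2"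
  using Re_deriv_cosh_root_square_ge[of "csqrt (s\<^sup>2 + of_real t)" l] abs_Im_csqrt_add_le[of t s]
      assms
  by simp

text \<open>The bound on the derivative, integrated along the segment from \<open>s\<^sup>2\<close>
  to \<open>s\<^sup>2 + t\<close>. For t > 0 it keeps the radicand in the right half plane, off the
  cut of \<open>csqrt\<close>, and shows that it grows at least linearly in
  \<open>t\<close>.\<close>

lemma Re_cosh_root_diff_ge:
  assumes "\<bar>Im s\<bar> \<le> l" "l < pi / 2" "t \<ge> 0"
  shows "Re (cosh_root (s\<^sup>2 + of_real t) - cosh_root (s\<^sup>2)) \<ge> cos l / 2 * t"
proof -
  define h where "h x = Re (cosh_root (s\<^sup>2 + of_real x)) - cos l / 2 * x" for x
  have "h 0 \<le> h t"
  proof (rule DERIV_nonneg_imp_nondecreasing[OF assms(3)])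
    fix x assume x: "0 \<le> x" "x \<le> t"
    have "((\<lambda>x. cosh_root (s\<^sup>2 + of_real x)) has_vector_derivative deriv cosh_root (s\<^sup>2 + of_real x)
        * 1) (at x)"
      by (rule has_vector_derivative_real_field[OF DERIV_chain2[OF DERIV_cosh_root]])
        (auto intro!: derivative_eq_intros)
    then have "(h has_field_derivative (Re (deriv cosh_root (s\<^sup>2 + of_real x)) - cos l / 2)) (at x)"
      unfolding h_def
      by (auto intro!: derivative_eq_intros )
    with Re_deriv_cosh_root_ge[OF assms(1,2) x(1)]
    show "\<exists>y. DERIV h x :> y \<and> 0 \<le> y" by force
  qed
  then show ?thesis by (simp add: h_def)
qed

text \<open>With w a root of v, |cosh| \<le> exp |w| on the disc of radius |w|, hence |sinh w| \<le>
  |w| exp |w|; the factor |w| cancels against sinh w = 2 w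
  \<open>deriv cosh_root (w\<^sup>2)\<close>.\<close>

lemma norm_deriv_cosh_root_le: "norm (deriv cosh_root v) \<le> exp (sqrt (norm v)) / 2"
proof (cases "v = 0")
  case True
  then show ?thesis by (simp add: deriv_cosh_root_0 norm_divide)
next
  case False
  define w where "w = csqrt v"
  have [simp]: "w \<noteq> 0" "norm w > 0" using False by (auto simp: w_def)
  have "norm (sinh w - sinh 0) \<le> exp (norm w) * norm (w - 0)"
  proof (rule field_differentiable_bound[of "cball 0 (norm w)" sinh cosh])
    fix z :: complex assume "z \<in> cball 0 (norm w)"
    then have "norm z \<le> norm w" by simp
    have "norm (cosh z) \<le> (norm (exp z) + norm (exp (-z))) / 2"
      using norm_triangle_ineq[of "exp z" "exp (- z)"] by (simp add: cosh_def)
    also have "\<dots> \<le> (exp (norm w) + exp (norm w)) / 2"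
      using norm_exp[of z] norm_exp[of "-z"] \<open>norm z \<le> norm w\<close> 
      by (smt (verit) exp_le_cancel_iff divide_right_mono norm_minus_cancel)
    finally show "norm (cosh z) \<le> exp (norm w)" by simp
  qed (auto intro!: derivative_eq_intros)
  then have "2 * norm w * norm (deriv cosh_root (w\<^sup>2)) \<le> exp (norm w) * norm w"
    unfolding deriv_cosh_root_square[of w, symmetric] by (simp add: norm_mult)
  then have "norm w * (2 * norm (deriv cosh_root (w\<^sup>2))) \<le> norm w * exp (norm w)"
    by (simp add: mult_ac)
  then have "2 * norm (deriv cosh_root (w\<^sup>2)) \<le> exp (norm w)"
    by (subst (asm) mult_le_cancel_left_pos) auto
  then show ?thesis by (simp add: w_def)
qed

subsection \<open>The kernel after the substitution \<open>u\<^sup>2 = s\<^sup>2 + t\<close>\<close>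

text \<open>
  In terms of \<open>u\<close> this is \<open>sinh u / (2 u) / sqrt (cosh u - cosh s)\<close>, where the factor \<open>1 / (2 u)\<close> comes
  from \<open>du = dt / (2 u)\<close>.
\<close>

definition sabr_kernel :: "complex \<Rightarrow> real \<Rightarrow> complex" where
  "sabr_kernel s t = deriv cosh_root (s\<^sup>2 + of_real t) / csqrt
      (cosh_root (s\<^sup>2 + of_real t) - cosh_root (s\<^sup>2))"

lemma Re_cosh_root_diff_pos:
  assumes "\<bar>Im s\<bar> < pi / 2" "t > 0"
  shows "Re (cosh_root (s\<^sup>2 + of_real t) - cosh_root (s\<^sup>2)) > 0"
proof -
  have "0 < cos (Im s) / 2 * t"
    using assms by (intro mult_pos_pos divide_pos_pos cos_gt_zero_pi) auto
  with Re_cosh_root_diff_ge[of s "\<bar>Im s\<bar>" t] assms show ?thesis by simp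
qed

lemma cosh_root_diff_notin_nonpos_Reals:
  assumes "\<bar>Im s\<bar> < pi / 2" "t > 0"
  shows "cosh_root (s\<^sup>2 + of_real t) - cosh_root (s\<^sup>2) \<notin> \<real>\<^sub>\<le>\<^sub>0"
  using Re_cosh_root_diff_pos[OF assms] by (auto simp: complex_nonpos_Reals_iff)

lemma csqrt_cosh_root_diff_nonzero:
  assumes "\<bar>Im s\<bar> < pi / 2" "t > 0"
  shows "csqrt (cosh_root (s\<^sup>2 + of_real t) - cosh_root (s\<^sup>2)) \<noteq> 0"
  using Re_cosh_root_diff_pos[OF assms] by auto

lemma norm_sabr_kernel_le:
  assumes "\<bar>Im s\<bar> \<le> l" "l < pi / 2" "t > 0"
  shows "norm (sabr_kernel s t) \<le> exp (norm s + sqrt t) / sqrt (cos l * t)"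
proof -
  let ?D = "cosh_root (s\<^sup>2 + of_real t) - cosh_root (s\<^sup>2)"
  have cos: "cos l > 0" using assms by (intro cos_gt_zero_pi) auto
  have "norm (s\<^sup>2 + of_real t) \<le> (norm s + sqrt t)\<^sup>2"
    using norm_triangle_ineq[of "s\<^sup>2" "of_real t"] assms
    by (simp add: power2_sum norm_power) (smt (verit) mult_nonneg_nonneg norm_ge_zero
        real_sqrt_ge_zero)
  then have "sqrt (norm (s\<^sup>2 + of_real t)) \<le> norm s + sqrt t"
    using assms by (intro real_le_lsqrt) auto
  then have 1: "norm (deriv cosh_root (s\<^sup>2 + of_real t)) \<le> exp (norm s + sqrt t) / 2"
    using norm_deriv_cosh_root_le[of "s\<^sup>2 + of_real t"]
        by (smt (verit) exp_le_cancel_iff divide_right_mono)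
  \<comment> \<open>Taking 1/4 instead of 1/2 gives away a factor sqrt 2, so that the halves in
    numerator and denominator cancel.\<close>
  have "cos l * t / 4 \<le> cos l / 2 * t" using cos assms by simp
  also have "\<dots> \<le> norm ?D"
    using Re_cosh_root_diff_ge[of s l t] assms complex_Re_le_cmod[of ?D] by simp
  finally have "sqrt (cos l * t / 4) \<le> sqrt (norm ?D)"
    by simp
  then have 2: "sqrt (cos l * t) / 2 \<le> norm (csqrt ?D)"
    by (simp add: real_sqrt_divide)
  have "norm (sabr_kernel s t) \<le> (exp (norm s + sqrt t) / 2) / (sqrt (cos l * t) / 2)"
    unfolding sabr_kernel_def norm_divide using 1 2 cos assms by (intro frac_le) auto
  then show ?thesis by simp
qed

lemma holomorphic_on_sabr_kernel:
  assumes "t > 0"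
  shows "(\<lambda>s. sabr_kernel s t) holomorphic_on {s. \<bar>Im s\<bar> < pi / 2}"
  unfolding sabr_kernel_def
  using cosh_root_diff_notin_nonpos_Reals[OF _ assms] csqrt_cosh_root_diff_nonzero[OF _ assms]
  by (intro holomorphic_intros) blast+

lemma continuous_on_sabr_kernel:
  assumes "continuous_on A f" "continuous_on A g" "\<And>x. x \<in> A \<Longrightarrow> \<bar>Im (f x)\<bar> < pi / 2"
      "\<And>x. x \<in> A \<Longrightarrow> g x > 0"
  shows "continuous_on A (\<lambda>x. sabr_kernel (f x) (g x))"
proof -
  have *: "continuous_on UNIV cosh_root" "continuous_on UNIV (deriv cosh_root)"
    by (intro holomorphic_on_imp_continuous_on holomorphic_on_cosh_root
        holomorphic_on_deriv_cosh_root holomorphic_on_ident)+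
  have **: "continuous_on A (\<lambda>x. cosh_root (h x))" "continuous_on A (\<lambda>x. deriv cosh_root (h x))"
    if "continuous_on A h" for h
    using that continuous_on_compose2[OF *(1)] continuous_on_compose2[OF *(2)] by auto
  have "continuous_on A (\<lambda>x. csqrt (cosh_root ((f x)\<^sup>2 + of_real (g x)) - cosh_root ((f x)\<^sup>2)))"
    using cosh_root_diff_notin_nonpos_Reals assms(3,4)
    by (intro continuous_on_compose2[OF holomorphic_on_imp_continuous_on[OF holomorphic_on_csqrt]]
        continuous_intros ** assms(1,2)) blast
  then show ?thesis
    unfolding sabr_kernel_def using csqrt_cosh_root_diff_nonzero assms(3,4)
    by (intro continuous_intros ** assms(1,2)) blast+
qed

section \<open>Values of the kernel on the real and imaginary axes\<close>

lemma cosh_root_of_real_in_Reals: "cosh_root (of_real v) \<in> \<real>"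
proof -
  have "summable (\<lambda>n. of_real (inverse (fact (2 * n)) * v ^ n) :: complex)"
    using cosh_root_summable[of "of_real v"] by simp
  then have "summable (\<lambda>n. inverse (fact (2 * n)) * v ^ n)"
    by (subst (asm) summable_complex_of_real)
  then have "cosh_root (of_real v) = of_real (\<Sum>n. inverse (fact (2 * n)) * v ^ n)"
    unfolding cosh_root_def by (subst suminf_of_real) auto
  then show ?thesis by simp
qed

lemma deriv_cosh_root_of_real_in_Reals: "deriv cosh_root (of_real v) \<in> \<real>"
proof -
  have "((\<lambda>x. cosh_root (of_real x)) has_vector_derivative deriv cosh_root (of_real v)) (at v)"
    by (rule has_vector_derivative_real_field[OF DERIV_cosh_root])
  then have "((\<lambda>x. Im (cosh_root (of_real x))) has_field_derivative Im
      (deriv cosh_root (of_real v))) (at v)"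
    by (rule has_field_derivative_Im)
  moreover have "(\<lambda>x. Im (cosh_root (of_real x))) = (\<lambda>_. 0)"
    using cosh_root_of_real_in_Reals complex_is_Real_iff by blast
  ultimately have "Im (deriv cosh_root (of_real v)) = 0"
    by (auto intro: DERIV_unique)
  then show ?thesis by (simp add: complex_is_Real_iff)
qed

text \<open>Realness of \<open>s\<^sup>2\<close> covers both the real axis, where the price integral
  lives, and the imaginary segment, which must drop out of the imaginary part. The kernel depends on
  \<open>s\<close> only through \<open>s\<^sup>2\<close>, and its radicand is then a positive
  real.\<close>

lemma sabr_kernel_in_Reals:
  assumes "\<bar>Im s\<bar> < pi / 2" "t > 0" "s\<^sup>2 \<in> \<real>"
  shows "sabr_kernel s t \<in> \<real>"
proof -
  obtain v where v: "s\<^sup>2 = of_real v" using assms(3) by (elim Reals_cases)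
  let ?D = "cosh_root (s\<^sup>2 + of_real t) - cosh_root (s\<^sup>2)"
  have "?D \<in> \<real>"
    unfolding v of_real_add[symmetric] by (intro Reals_diff cosh_root_of_real_in_Reals)
  then have "csqrt ?D = of_real (sqrt (Re ?D))"
    using Re_cosh_root_diff_pos[OF assms(1,2)]
        by (intro csqrt_of_real_nonneg) (auto simp: complex_is_Real_iff)
  moreover have "deriv cosh_root (s\<^sup>2 + of_real t) \<in> \<real>"
    unfolding v of_real_add[symmetric] by (rule deriv_cosh_root_of_real_in_Reals)
  ultimately show ?thesis
    unfolding sabr_kernel_def by (metis Reals_divide Reals_of_real)
qed

lemma sinh_complex_of_real: "sinh (complex_of_real x) = of_real (sinh x)"
  and cosh_complex_of_real: "cosh (complex_of_real x) = of_real (cosh x)"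
  by (simp_all add: sinh_def cosh_def scaleR_conv_of_real flip: exp_of_real)

lemma sabr_kernel_of_real:
  fixes x t :: real
  assumes "t > 0"
  defines "u \<equiv> sqrt (x\<^sup>2 + t)"
  shows "sabr_kernel (of_real x) t = of_real (sinh u / (2 * u) / sqrt (cosh u - cosh x))"
proof -
  have u: "u > 0" "u\<^sup>2 = x\<^sup>2 + t"
    using assms(1) by (auto simp: u_def add_nonneg_pos)
  have "\<bar>x\<bar> \<le> u"
    unfolding u_def using assms(1) by (intro real_le_rsqrt) auto
  then have cosh: "cosh x \<le> cosh u"
    using cosh_real_nonneg_le_iff[of "\<bar>x\<bar>" u] by simp
  have eq: "(of_real x)\<^sup>2 + complex_of_real t = (of_real u)\<^sup>2"
    by (metis of_real_add of_real_power u(2))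
  have "deriv cosh_root ((of_real u)\<^sup>2) = of_real (sinh u / (2 * u))"
    using deriv_cosh_root_square[of "of_real u"] u by (simp add: field_simps sinh_complex_of_real)
  then show ?thesis
    unfolding sabr_kernel_def eq cosh_root_square
    using cosh by (simp add: csqrt_of_real cosh_complex_of_real flip: of_real_diff)
qed

subsection \<open>The contour shift\<close>

lemma set_integrable_exp_minus: "set_integrable lborel {0<..} (\<lambda>x::real. exp (- x))"
proof -
  have "set_integrable lborel (einterval 0 \<infinity>) (\<lambda>x::real. exp (- x))"
  proof (rule interval_integral_FTC_nonneg(1)[where F = "\<lambda>x. - exp (- x)" and A = "-1" and B = 0])
    show "(((\<lambda>x. - exp (- x)) \<circ> real_of_ereal) \<longlongrightarrow> - 1) (at_right 0)"
      unfolding zero_ereal_def ereal_tendsto_simps1 by (auto intro!: tendsto_eq_intros)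
    show "(((\<lambda>x::real. - exp (- x)) \<circ> real_of_ereal) \<longlongrightarrow> 0) (at_left \<infinity>)"
      unfolding ereal_tendsto_simps1 by real_asymp
  qed (auto intro!: derivative_eq_intros)
  then show ?thesis by (simp add: einterval_def zero_ereal_def greaterThan_def)
qed

text \<open>Half the residue contribution of the pole of \<open>1 / sinh\<close> at \<open>0\<close>.\<close>

lemma
  fixes l :: real
  assumes "0 < l" "l < pi / 2"
  shows set_integrable_inverse_sinh: "set_integrable lborel {0<..}
      (\<lambda>x. Im (1 / sinh (Complex x l)))"
    and set_integral_Im_inverse_sinh: "(LBINT x:{0<..}. Im (1 / sinh (Complex x l))) = - pi / 2"
proof -
  \<comment> \<open>This is -Im (1 / sinh (x + il)). Its primitive arctan (sinh x / sin l) rises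
    from 0 to pi/2 on the half line.\<close>
  define f where "f x = cosh x * sin l / ((sinh x)\<^sup>2 + (sin l)\<^sup>2)" for x :: real
  have sin: "sin l > 0" using assms by (intro sin_gt_zero) auto
  have pos: "(sinh x)\<^sup>2 + (sin l)\<^sup>2 > 0" for x :: real
    using sin by (intro add_nonneg_pos) auto
  have deriv: "((\<lambda>x. arctan (sinh x / sin l)) has_field_derivative f x) (at x)" for x
  proof -
    have "1 + (sinh x / sin l)\<^sup>2 > 0" by (intro add_pos_nonneg) auto
    then have "cosh x / sin l * inverse (1 + (sinh x / sin l)\<^sup>2) = f x"
      unfolding f_def using sin pos[of x] by (simp add: divide_simps)
          (simp add: power2_eq_square algebra_simps)
    then show ?thesis
      using sin by (auto intro!: derivative_eq_intros simp: divide_simps mult_ac)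
  qed
  have lim: "((\<lambda>x. arctan (sinh x / sin l)) \<longlongrightarrow> pi / 2) at_top"
  proof (rule filterlim_compose[OF tendsto_arctan_at_top])
    show "filterlim (\<lambda>x. sinh x / sin l) at_top at_top"
      using sin by real_asymp
  qed
  have FTC: "set_integrable lborel (einterval 0 \<infinity>) f" "(LBINT x=0..\<infinity>. f x) = pi / 2 - 0"
  proof (rule_tac [!] interval_integral_FTC_nonneg[where F = "\<lambda>x. arctan (sinh x / sin l)"])
    show "(((\<lambda>x. arctan (sinh x / sin l)) \<circ> real_of_ereal) \<longlongrightarrow> 0) (at_right 0)"
      unfolding zero_ereal_def ereal_tendsto_simps1 using sin by (auto intro!: tendsto_eq_intros)
    then show "(((\<lambda>x. arctan (sinh x / sin l)) \<circ> real_of_ereal) \<longlongrightarrow> 0) (at_right 0)" .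
    show "(((\<lambda>x. arctan (sinh x / sin l)) \<circ> real_of_ereal) \<longlongrightarrow> pi / 2) (at_left \<infinity>)"
      unfolding ereal_tendsto_simps1 by (rule lim)
    then show "(((\<lambda>x. arctan (sinh x / sin l)) \<circ> real_of_ereal) \<longlongrightarrow> pi / 2) (at_left \<infinity>)" .
    have "isCont f x" for x
      unfolding f_def using pos[of x] by (intro continuous_intros) auto
    then show "isCont f x" "isCont f x" for x by auto
    have "0 \<le> f x" for x
      unfolding f_def using sin pos[of x] by (intro divide_nonneg_pos mult_nonneg_nonneg) auto
    then show "AE x in lborel. 0 < ereal x \<longrightarrow> ereal x < \<infinity> \<longrightarrow> 0 \<le> f x"
      "AE x in lborel. 0 < ereal x \<longrightarrow> ereal x < \<infinity> \<longrightarrow> 0 \<le> f x" by auto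
  qed (auto intro: deriv)
  have Im: "Im (1 / sinh (Complex x l)) = - f x" for x
  proof -
    have "(sinh x * cos l)\<^sup>2 + (cosh x * sin l)\<^sup>2 = (sinh x)\<^sup>2 + (sin l)\<^sup>2"
      unfolding power_mult_distrib cosh_square_eq cos_squared_eq by (simp add: algebra_simps)
    then show ?thesis
      by (simp add: f_def Im_divide Re_sinh Im_sinh)
  qed
  have int: "set_integrable lborel {0<..} f" "(LBINT x:{0<..}. f x) = pi / 2"
    using FTC
        by (simp_all add: einterval_def greaterThan_def zero_ereal_def
            interval_integral_to_infinity_eq)
  show "set_integrable lborel {0<..} (\<lambda>x. Im (1 / sinh (Complex x l)))"
    using set_integrable_mult_right[of "-1" lborel "{0<..}" f] int(1) unfolding Im by simp
  show "(LBINT x:{0<..}. Im (1 / sinh (Complex x l))) = - pi / 2"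
    unfolding Im using set_integral_uminus[OF int(1)] int(2) by simp
qed

text \<open>Both follow from |sinh s|^2 = sinh^2 (Re s) + sin^2 (Im s). The first controls the
  vertical sides far out, the second the line Im s = l uniformly.\<close>

lemma norm_sinh_ge:
  fixes s :: complex
  shows "\<bar>sinh (Re s)\<bar> \<le> norm (sinh s)" "\<bar>sin (Im s)\<bar> * cosh (Re s) \<le> norm (sinh s)"
proof -
  have eq: "(norm (sinh s))\<^sup>2 = (sinh (Re s))\<^sup>2 + (sin (Im s))\<^sup>2"
    unfolding cmod_power2 Re_sinh Im_sinh power_mult_distrib cosh_square_eq cos_squared_eq
    by (simp add: algebra_simps)
  then show "\<bar>sinh (Re s)\<bar> \<le> norm (sinh s)"
    by (simp add: abs_le_square_iff[of _ "norm (sinh s)", simplified])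
  have "(sin (Im s) * cosh (Re s))\<^sup>2 = (sin (Im s))\<^sup>2 * (sinh (Re s))\<^sup>2 + (sin (Im s))\<^sup>2"
    unfolding power_mult_distrib cosh_square_eq by (simp add: algebra_simps)
  also have "\<dots> \<le> 1 * (sinh (Re s))\<^sup>2 + (sin (Im s))\<^sup>2"
    by (intro add_right_mono mult_right_mono) (auto simp: abs_square_le_1)
  finally have "(sin (Im s) * cosh (Re s))\<^sup>2 \<le> (norm (sinh s))\<^sup>2"
    using eq by simp
  then have "\<bar>sin (Im s) * cosh (Re s)\<bar> \<le> norm (sinh s)"
    by (simp add: abs_le_square_iff[of _ "norm (sinh s)", simplified])
  then show "\<bar>sin (Im s)\<bar> * cosh (Re s) \<le> norm (sinh s)"
    by (simp add: abs_mult)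
qed

lemma inverse_sinh_bound:
  assumes "0 < l" "l < pi / 2"
  shows "norm (1 / sinh (Complex x l)) \<le> 2 / sin l * exp (- x)"
    "norm (1 / sinh (Complex x l)) \<le> 1 / sin l"
proof -
  have sin: "sin l > 0" using assms by (intro sin_gt_zero) auto
  let ?n = "norm (sinh (Complex x l))"
  have n: "sin l * cosh x \<le> ?n" using norm_sinh_ge(2)[of "Complex x l"] sin by simp
  have "exp x / 2 \<le> cosh x" by (simp add: cosh_def)
  with sin n have "sin l * (exp x / 2) \<le> ?n" by (meson mult_left_mono less_imp_le order_trans)
  moreover have "0 < sin l * (exp x / 2)" using sin by simp
  ultimately have "1 / ?n \<le> 1 / (sin l * (exp x / 2))" by (intro frac_le) auto
  then show "norm (1 / sinh (Complex x l)) \<le> 2 / sin l * exp (- x)"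
    by (simp add: norm_divide exp_minus field_simps)
  have "sin l * 1 \<le> sin l * cosh x" using sin by (intro mult_left_mono cosh_real_ge_1) auto
  with n have "sin l \<le> ?n" by linarith
  with sin have "1 / ?n \<le> 1 / sin l" by (intro frac_le) auto
  then show "norm (1 / sinh (Complex x l)) \<le> 1 / sin l"
    by (simp add: norm_divide)
qed

lemma holomorphic_on_sinh [holomorphic_intros]:
  "f holomorphic_on A \<Longrightarrow> (\<lambda>z. sinh (f z)) holomorphic_on A" for f :: "complex \<Rightarrow> complex"
  unfolding sinh_def scaleR_conv_of_real by (intro holomorphic_intros)

lemma open_strip: "open {s. \<bar>Im s\<bar> < r}"
  and convex_strip: "convex {s. \<bar>Im s\<bar> < r}"
proof -
  have eq: "{s. \<bar>Im s\<bar> < r} = {s. Im s < r} \<inter> {s. Im s > - r}" by auto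
  show "open {s. \<bar>Im s\<bar> < r}" unfolding eq
      by (intro open_Int open_halfspace_Im_lt open_halfspace_Im_gt)
  show "convex {s. \<bar>Im s\<bar> < r}" unfolding eq
      by (intro convex_Int convex_halfspace_Im_lt convex_halfspace_Im_gt)
qed

text \<open>Closes the contour at infinity. The increment of the primitive \<open>F\<close> across
  the vertical side is at most its length \<open>l\<close> times a bound of the derivative
  there.\<close>

lemma vertical_difference_tendsto_0:
  fixes F :: "complex \<Rightarrow> complex"
  assumes F: "\<And>s. \<bar>Im s\<bar> < r \<Longrightarrow> (F has_field_derivative h s) (at s)"
    and l: "0 < l" "l < r"
    and h: "\<And>s. 0 < Re s \<Longrightarrow> 0 \<le> Im s \<Longrightarrow> Im s \<le> l \<Longrightarrow> norm (h s) \<le> b (Re s)"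
    and b: "(b \<longlongrightarrow> 0) at_top"
  shows "((\<lambda>x. F (Complex x l) - F (of_real x)) \<longlongrightarrow> 0) at_top"
proof -
  have "\<forall>\<^sub>F x in at_top. norm (F (Complex x l) - F (of_real x)) \<le> norm (b x) * l"
    using eventually_gt_at_top[of "0::real"]
  proof eventually_elim
    case (elim x)
    let ?S = "closed_segment (of_real x) (Complex x l)"
    have S: "Re s = x" "0 \<le> Im s" "Im s \<le> l" if "s \<in> ?S" for s
    proof -
      from that obtain u where u: "0 \<le> u" "u \<le> 1" "s = (1 - u) *\<^sub>R of_real x + u *\<^sub>R Complex x l"
        unfolding closed_segment_def by blast
      have "Re s = (1 - u) * x + u * x" "Im s = u * l" unfolding u(3) by simp_all
      then show "Re s = x" "0 \<le> Im s" "Im s \<le> l"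
        using u(1,2) l mult_right_mono[of u 1 l] by (simp_all add: algebra_simps)
    qed
    have "norm (F (Complex x l) - F (of_real x)) \<le> b x * norm (Complex x l - of_real x)"
    proof (rule field_differentiable_bound[of ?S F h])
      fix s assume s: "s \<in> ?S"
      show "(F has_field_derivative h s) (at s within ?S)"
        using S(2,3)[OF s] l(2) by (intro has_field_derivative_at_within[OF F]) linarith
      show "norm (h s) \<le> b x"
        using h[OF _ S(2)[OF s] S(3)[OF s]] S(1)[OF s] elim by simp
    qed (rule convex_closed_segment ends_in_segment)+
    moreover have "norm (Complex x l - of_real x) = l"
      using l by (simp add: cmod_def)
    ultimately have "norm (F (Complex x l) - F (of_real x)) \<le> b x * l" by simp
    also have "\<dots> \<le> norm (b x) * l" using l by (intro mult_right_mono) auto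
    finally show ?case .
  qed
  with b show ?thesis by (rule tendsto_0_le)
qed

lemma set_borel_measurable_lborel:
  fixes f :: "'a :: euclidean_space \<Rightarrow> 'b :: real_normed_vector"
  assumes "continuous_on A f" "A \<in> sets borel"
  shows "set_borel_measurable lborel A f"
  using borel_measurable_continuous_on_indicator[OF assms(2,1)]
  by (simp add: set_borel_measurable_def)

text \<open>
  Only the right half of the contour is used. Subtracting \<open>Q 0\<close> from the numerator removes the pole,
  and the resulting holomorphic function is real after multiplication by \<open>\<i>\<close> on the imaginary axis, so
  a primitive of it has constant imaginary part on the vertical side from \<open>0\<close> to \<open>\<i> l\<close>.
\<close>

lemma contour_shift:
  fixes Q :: "complex \<Rightarrow> complex" and \<rho> l B :: real
  assumes \<rho>: "0 < \<rho>" and l: "0 < l" "l < pi / 2"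
    and Q: "Q holomorphic_on {s. \<bar>Im s\<bar> < pi / 2}"
    and bound: "\<And>s. 0 \<le> Re s \<Longrightarrow> 0 \<le> Im s \<Longrightarrow> Im s \<le> l \<Longrightarrow> norm (Q s) \<le> B * exp (- Re s)"
    and real: "\<And>s. \<bar>Im s\<bar> < pi / 2 \<Longrightarrow> s\<^sup>2 \<in> \<real> \<Longrightarrow> Q s \<in> \<real>"
  defines "E \<equiv> \<lambda>s. exp (\<i> * of_real \<rho> * sinh s) * Q s / sinh s"
  shows "(LBINT x:{0<..}. sin (\<rho> * sinh x) / sinh x * Re (Q (of_real x))) =
    (LBINT x:{0<..}. Im (E (Complex x l))) + pi / 2 * Re (Q 0)"
proof -
  let ?U = "{s. \<bar>Im s\<bar> < pi / 2}"
  define N where "N s = exp (\<i> * of_real \<rho> * sinh s) * Q s - Q 0" for s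
  \<comment> \<open>This is N s / sinh s with the singularity at 0 filled in. As sinh s = 2 s
    \<open>deriv cosh_root (s\<^sup>2)\<close> and the last factor has no zero in the strip, only N
    s / s needs the removable-singularity argument.\<close>
  define h where "h s = (if s = 0 then deriv N 0 else N s / s) / (2 * deriv cosh_root (s\<^sup>2))" for s
  have N: "N holomorphic_on ?U" unfolding N_def by (intro holomorphic_intros Q)
  have N0 [simp]: "N 0 = 0" by (simp add: N_def)
  have h_eq: "h s = N s / sinh s" if "s \<noteq> 0" for s
    unfolding h_def using that by (simp flip: deriv_cosh_root_square)
  have nz: "deriv cosh_root (s\<^sup>2) \<noteq> 0" if "s \<in> ?U" for s
  proof -
    have "0 < cos (Im s) / 2" using that by (intro divide_pos_pos cos_gt_zero_pi) auto
    with Re_deriv_cosh_root_square_ge[of s "\<bar>Im s\<bar>"] that show ?thesis by auto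
  qed
  have h: "h holomorphic_on ?U"
    unfolding h_def using nz
    by (intro holomorphic_intros pole_theorem_open_0[OF N open_strip, where a = 0]) auto
  obtain F where "\<And>s. s \<in> ?U \<Longrightarrow> (F has_field_derivative h s) (at s within ?U)"
    using holomorphic_convex_primitive'[OF convex_strip open_strip h] by blast
  then have F: "(F has_field_derivative h s) (at s)" if "\<bar>Im s\<bar> < pi / 2" for s
    using that at_within_open[OF _ open_strip] by (metis mem_Collect_eq)
  have B: "0 \<le> B" using order_trans[OF norm_ge_zero bound[of 0]] l by simp

  have Im_F: "Im (F (\<i> * of_real l)) - Im (F 0) = 0"
  proof -
    have deriv: "((\<lambda>b. F (\<i> * of_real b)) has_vector_derivative h (\<i> * of_real b) * \<i>) (at b)"
      if "0 \<le> b" "b \<le> l" for b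
      using that l by (intro has_vector_derivative_real_field DERIV_chain2[OF F])
        (auto intro!: derivative_eq_intros)
    have "Im (F (\<i> * of_real l)) = Im (F (\<i> * of_real 0))"
    proof (rule DERIV_isconst_end[OF l(1)])
      show "continuous_on {0..l} (\<lambda>b. Im (F (\<i> * of_real b)))"
        using deriv by (intro continuous_intros continuous_at_imp_continuous_on ballI)
          (meson atLeastAtMost_iff has_vector_derivative_continuous)
      fix b :: real assume b: "0 < b" "b < l"
      \<comment> \<open>At the point ib the exponential equals exp (- \<rho> sin b), so
        \<open>N\<close> is real there while sinh is imaginary. Hence \<open>h\<close> is purely
        imaginary.\<close>
      have "Q (\<i> * of_real b) \<in> \<real>" "Q 0 \<in> \<real>"
        using b l by (auto intro!: real simp: power_mult_distrib)
      moreover have "sinh (\<i> * of_real b) = \<i> * of_real (sin b)"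
        by (simp add: complex_eq_iff Re_sinh Im_sinh)
      ultimately have "Re (h (\<i> * of_real b)) = 0"
        using b by (simp add: h_eq N_def complex_is_Real_iff exp_eq_polar Re_divide Im_divide Im_exp
            Re_exp)
      then show "((\<lambda>b. Im (F (\<i> * of_real b))) has_field_derivative 0) (at b)"
        using has_field_derivative_Im[OF deriv[of b]] b by simp
    qed
    then show ?thesis by simp
  qed

  \<comment> \<open>Because of the constant \<open>Q 0\<close>, \<open>N\<close> is merely bounded;
    the decay comes from 1 / sinh. The exponential has modulus at most 1, since Im (sinh s) \<ge> 0
    in this region.\<close>
  have norm_h: "norm (h s) \<le> (B + norm (Q 0)) / sinh (Re s)" if "0 < Re s" "0 \<le> Im s" "Im s \<le> l"
      for s
  proof -
    have "norm (exp (\<i> * of_real \<rho> * sinh s)) \<le> 1"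
      using that \<rho> l by (auto simp: Im_sinh intro!: mult_nonneg_nonneg sin_ge_zero)
    moreover have "norm (Q s) \<le> B"
      using bound[of s] that mult_left_mono[of "exp (- Re s)" 1 B] B by simp
    ultimately have "norm (exp (\<i> * of_real \<rho> * sinh s) * Q s) \<le> 1 * B"
      unfolding norm_mult by (intro mult_mono) auto
    then have "norm (N s) \<le> 1 * B + norm (Q 0)"
      unfolding N_def by (intro order_trans[OF norm_triangle_ineq4] add_mono order_refl)
    moreover have "sinh (Re s) \<le> norm (sinh s)" "0 < sinh (Re s)"
      using norm_sinh_ge(1)[of s] that by auto
    moreover have "s \<noteq> 0" using that by auto
    ultimately show ?thesis
      using B by (auto simp: h_eq norm_divide intro!: frac_le)
  qed
  have lim: "((\<lambda>x. F (Complex x l) - F (of_real x)) \<longlongrightarrow> 0) at_top"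
  proof (rule vertical_difference_tendsto_0[where r = "pi / 2", OF F _ _ norm_h])
    show "((\<lambda>x. (B + norm (Q 0)) / sinh x) \<longlongrightarrow> 0) at_top" by real_asymp
  qed (use l in auto)

  have Qr: "Q 0 \<in> \<real>" "\<And>x. Q (of_real x) \<in> \<real>" by (auto intro!: real)
  have contQ: "continuous_on A (\<lambda>x. Q (f x))"
      if "continuous_on A f" "\<And>x. x \<in> A \<Longrightarrow> \<bar>Im (f x)\<bar> < pi / 2" for f :: "real \<Rightarrow> complex" and A
    using continuous_on_compose2[OF holomorphic_on_imp_continuous_on[OF Q] that(1)] that(2) by auto
  have contC: "continuous_on A (\<lambda>x. Complex x l)" for A
    unfolding Complex_eq by (intro continuous_intros)
  have sinh_nz: "sinh (Complex x l) \<noteq> 0" for x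
  proof -
    have "0 < \<bar>sin l\<bar> * cosh x" using l sin_gt_zero[of l] by (intro mult_pos_pos) auto
    with norm_sinh_ge(2)[of "Complex x l"] show ?thesis by auto
  qed

  \<comment> \<open>On the real axis the subtracted constant is real over real and leaves the
    imaginary part alone. On the shifted line it does not, and this mismatch, recorded in
    \<open>h_line\<close>, becomes the \<open>pi / 2 * Re (Q 0)\<close> of the conclusion.\<close>
  have h_real: "Im (h (of_real x)) = sin (\<rho> * sinh x) / sinh x * Re (Q (of_real x))" if "0 < x"
      for x
  proof -
    have "h (of_real x) = (cis (\<rho> * sinh x) * Q (of_real x) - Q 0) / of_real (sinh x)"
      using that by (simp add: h_eq N_def sinh_complex_of_real cis_conv_exp mult.assoc)
    then show ?thesis
      using Qr(1) Qr(2)[of x] by (simp add: complex_is_Real_iff)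
  qed
  have h_line: "Im (h (Complex x l)) = Im (E (Complex x l)) - Re (Q 0) *
      Im (1 / sinh (Complex x l))" for x
  proof -
    have "h (Complex x l) = E (Complex x l) - of_real (Re (Q 0)) * (1 / sinh (Complex x l))"
      using l Qr(1) by (subst h_eq) (auto simp: complex_eq_iff N_def E_def diff_divide_distrib
          complex_is_Real_iff)
    from arg_cong[OF this, of Im] show ?thesis
        by (simp only: minus_complex.simps times_complex.simps Re_complex_of_real Im_complex_of_real
            mult_zero_left add_0_right)
  qed

  have int1: "set_integrable lborel {0<..} (\<lambda>x. sin (\<rho> * sinh x) / sinh x * Re (Q (of_real x)))"
  proof (rule set_integrable_bound[where f = "\<lambda>x. \<rho> * B * exp (- x)"])
    show "set_borel_measurable lborel {0<..} (\<lambda>x. sin (\<rho> * sinh x) / sinh x * Re (Q (of_real x)))"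
      by (intro set_borel_measurable_lborel continuous_intros contQ) auto
    show "AE x in lborel. x \<in> {0<..} \<longrightarrow> norm (sin (\<rho> * sinh x) / sinh x * Re (Q (of_real x))) \<le>
        norm (\<rho> * B * exp (- x))"
    proof (intro AE_I2 impI)
      fix x :: real assume x: "x \<in> {0<..}"
      have "\<bar>sin (\<rho> * sinh x) / sinh x\<bar> \<le> \<rho>"
        using abs_sin_x_le_abs_x[of "\<rho> * sinh x"] x \<rho> by (simp add: abs_mult field_simps)
      moreover have "\<bar>Re (Q (of_real x))\<bar> \<le> B * exp (- x)"
        using bound[of "of_real x"] x l abs_Re_le_cmod[of "Q (of_real x)"] by simp
      ultimately have "\<bar>sin (\<rho> * sinh x) / sinh x\<bar> * \<bar>Re (Q (of_real x))\<bar> \<le> \<rho> * (B * exp (- x))"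
        using \<rho> by (intro mult_mono) auto
      then show "norm (sin (\<rho> * sinh x) / sinh x * Re (Q (of_real x))) \<le> norm (\<rho> * B * exp (- x))"
        using \<rho> B by (simp add: abs_mult)
    qed
  qed (intro set_integrable_mult_right set_integrable_exp_minus)
  have int2: "set_integrable lborel {0<..} (\<lambda>x. Im (E (Complex x l)))"
  proof (rule set_integrable_bound[where f = "\<lambda>x. B / sin l * exp (- x)"])
    show "set_borel_measurable lborel {0<..} (\<lambda>x. Im (E (Complex x l)))"
      unfolding E_def using sinh_nz l
          by (intro set_borel_measurable_lborel continuous_intros contQ contC) auto
    show "AE x in lborel. x \<in> {0<..} \<longrightarrow> norm (Im (E (Complex x l))) \<le> norm (B / sin l * exp (- x))"
    proof (intro AE_I2 impI)
      fix x :: real assume x: "x \<in> {0<..}"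
      have sin: "sin l > 0" using l by (intro sin_gt_zero) auto
      have "norm (exp (\<i> * of_real \<rho> * sinh (Complex x l))) \<le> 1"
        using \<rho> l by (auto simp: Im_sinh intro!: mult_nonneg_nonneg sin_ge_zero)
      moreover have "norm (Q (Complex x l)) \<le> B * exp (- x)" using bound[of "Complex x l"] x l
          by simp
      ultimately have "norm (exp (\<i> * of_real \<rho> * sinh (Complex x l))) * norm (Q (Complex x l)) *
          norm (1 / sinh (Complex x l))
          \<le> 1 * (B * exp (- x)) * (1 / sin l)"
        using B sin by (intro mult_mono inverse_sinh_bound l mult_nonneg_nonneg) auto
      then show "norm (Im (E (Complex x l))) \<le> norm (B / sin l * exp (- x))"
        using abs_Im_le_cmod[of "E (Complex x l)"] B sin by (simp add: E_def norm_mult norm_divide)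
    qed
  qed (intro set_integrable_mult_right set_integrable_exp_minus)
  note int3 = set_integrable_mult_right[of "Re (Q 0)", OF set_integrable_inverse_sinh[OF l]]
  have "set_integrable lborel {0<..} (\<lambda>x. Im (h (of_real x)))"
    using int1 by (subst set_integrable_cong[OF refl refl h_real]) auto
  moreover have int4: "set_integrable lborel {0<..} (\<lambda>x. Im (h (Complex x l)))"
    unfolding h_line by (intro set_integral_diff int2 int3)
  ultimately have int: "set_integrable lborel {0<..}
      (\<lambda>x. Im (h (Complex x l)) - Im (h (of_real x)))"
    by (intro set_integral_diff)

  \<comment> \<open>A primitive of the difference of the two horizontal integrands.
    \<open>G 0 = 0\<close> is the vanishing contribution of the vertical segment, and the limit 0 at
    infinity is that of the far vertical side.\<close>
  define G where "G x = Im (F (Complex x l) - F (of_real x))" for x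
  have G: "(G has_field_derivative Im (h (Complex x l)) - Im (h (of_real x))) (at x)" for x
  proof -
    have "((\<lambda>x. F (Complex x l) - F (of_real x)) has_vector_derivative h (Complex x l) *
        1 - h (of_real x) * 1) (at x)"
      unfolding Complex_eq using l
      by (intro has_vector_derivative_diff has_vector_derivative_real_field DERIV_chain2[OF F])
        (auto intro!: derivative_eq_intros)
    from has_field_derivative_Im[OF this] show ?thesis by (simp add: G_def [abs_def])
  qed
  have conth: "continuous_on A (\<lambda>x. h (f x))"
      if "continuous_on A f" "\<And>x. x \<in> A \<Longrightarrow> \<bar>Im (f x)\<bar> < pi / 2" for f :: "real \<Rightarrow> complex" and A
    using continuous_on_compose2[OF holomorphic_on_imp_continuous_on[OF h] that(1)] that(2) by auto
  have "(LBINT x=0..\<infinity>. Im (h (Complex x l)) - Im (h (of_real x))) = 0 - G 0"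
  proof (rule interval_integral_FTC_integrable[where F = G])
    show "(G has_vector_derivative Im (h (Complex x l)) - Im (h (of_real x))) (at x)" for x
      using G by (simp add: has_real_derivative_iff_has_vector_derivative)
    have "continuous_on UNIV (\<lambda>x. Im (h (Complex x l)) - Im (h (of_real x)))"
      using l by (intro continuous_intros conth contC) auto
    then show "isCont (\<lambda>x. Im (h (Complex x l)) - Im (h (of_real x))) x" for x
      by (simp add: continuous_on_eq_continuous_at)
    show "((G \<circ> real_of_ereal) \<longlongrightarrow> G 0) (at_right 0)"
      unfolding zero_ereal_def ereal_tendsto_simps1
      using DERIV_isCont[OF G[of 0]] by (simp add: isCont_def filterlim_at_split)
    show "((G \<circ> real_of_ereal) \<longlongrightarrow> 0) (at_left \<infinity>)"
      unfolding ereal_tendsto_simps1 G_def using tendsto_Im[OF lim] by simp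
    show "set_integrable lborel (einterval 0 \<infinity>) (\<lambda>x. Im (h (Complex x l)) - Im (h (of_real x)))"
      using int by (simp add: einterval_def greaterThan_def zero_ereal_def)
  qed auto
  moreover have "G 0 = 0" using Im_F by (simp add: G_def Complex_eq)
  ultimately have "(LBINT x:{0<..}. Im (h (Complex x l)) - Im (h (of_real x))) = 0"
    by (simp add: zero_ereal_def interval_integral_to_infinity_eq)
  then have "(LBINT x:{0<..}. Im (h (of_real x))) = (LBINT x:{0<..}. Im (h (Complex x l)))"
    using set_integral_diff(2)[OF int4 \<open>set_integrable lborel {0<..} (\<lambda>x. Im (h (of_real x)))\<close>]
        by simp
  also have "(LBINT x:{0<..}. Im (h (of_real x))) =
      (LBINT x:{0<..}. sin (\<rho> * sinh x) / sinh x * Re (Q (of_real x)))"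
    using h_real by (intro set_lebesgue_integral_cong) auto
  also have "(LBINT x:{0<..}. Im (h (Complex x l))) =
      (LBINT x:{0<..}. Im (E (Complex x l))) - Re (Q 0) * (- pi / 2)"
    unfolding h_line set_integral_diff(2)[OF int2 int3] 
    by (subst set_integral_mult_right) (simp only: set_integral_Im_inverse_sinh[OF l])
  finally show ?thesis by simp
qed

subsection \<open>The price as a double integral over the kernel\<close>

text \<open>The weight exp (- c t) must absorb the kernel's growth exp (sqrt t) / sqrt t. From (c
  sqrt t - 1)^2 \<ge> 0 one gets 2 sqrt t \<le> c t + 1/c, which leaves exp (- sqrt t) / sqrt t,
  with the explicit primitive -2 exp (- sqrt t).\<close>

lemma set_integrable_exp_sqrt:
  fixes c :: real
  assumes "0 < c"
  shows "set_integrable lborel {0<..} (\<lambda>t. exp (- c * t) * (exp (sqrt t) / sqrt t))"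
proof (rule set_integrable_bound)
  have "set_integrable lborel (einterval 0 \<infinity>) (\<lambda>t. exp (- sqrt t) / sqrt t)"
  proof (rule interval_integral_FTC_nonneg(1)[where F = "\<lambda>t. - 2 * exp (- sqrt t)" and A = "-2"
      and B = 0])
    show "(((\<lambda>t. - 2 * exp (- sqrt t)) \<circ> real_of_ereal) \<longlongrightarrow> - 2) (at_right 0)"
      unfolding zero_ereal_def ereal_tendsto_simps1 by (auto intro!: tendsto_eq_intros)
    show "(((\<lambda>t. - 2 * exp (- sqrt t)) \<circ> real_of_ereal) \<longlongrightarrow> 0) (at_left \<infinity>)"
      unfolding ereal_tendsto_simps1 by real_asymp
  qed (auto intro!: derivative_eq_intros continuous_intros AE_I2 simp: field_simps)
  then show "set_integrable lborel {0<..} (\<lambda>t. exp (1 / c) * (exp (- sqrt t) / sqrt t))"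
    by (intro set_integrable_mult_right) (simp add: einterval_def zero_ereal_def greaterThan_def)
  show "set_borel_measurable lborel {0<..} (\<lambda>t. exp (- c * t) * (exp (sqrt t) / sqrt t))"
    by (intro set_borel_measurable_lborel continuous_intros) auto
  show "AE t in lborel. t \<in> {0<..} \<longrightarrow> norm (exp (- c * t) * (exp (sqrt t) / sqrt t)) \<le>
      norm (exp (1 / c) * (exp (- sqrt t) / sqrt t))"
  proof (intro AE_I2 impI)
    fix t :: real assume t: "t \<in> {0<..}"
    have "0 \<le> (c * sqrt t - 1)\<^sup>2 / c" using assms by simp
    also have "\<dots> = c * t - 2 * sqrt t + 1 / c"
      using assms t by (simp add: power2_diff power_mult_distrib field_simps power2_eq_square)
    finally have "exp (- c * t + sqrt t) \<le> exp (1 / c + - sqrt t)" by simp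
    then show "norm (exp (- c * t) * (exp (sqrt t) / sqrt t)) \<le>
        norm (exp (1 / c) * (exp (- sqrt t) / sqrt t))"
      using t by (simp add: divide_right_mono flip: exp_add)
  qed
qed

text \<open>Completing the square (x - 2T)^2. It trades Gaussian decay for the plain factor exp (-
  x) that \<open>contour_shift\<close> requires.\<close>

lemma exp_minus_square_le:
  fixes x :: real
  assumes "0 < T"
  shows "exp (x - x\<^sup>2 / (2 * T)) \<le> exp (2 * T) * exp (- x)"
proof -
  have "0 \<le> (x - 2 * T)\<^sup>2 / (2 * T)" using assms by simp
  also have "\<dots> = x\<^sup>2 / (2 * T) - 2 * x + 2 * T"
    using assms by (simp add: power2_diff field_simps power2_eq_square)
  finally show ?thesis by (simp flip: exp_add)
qed

lemma set_integrable_exp_minus_square: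
  fixes T :: real
  assumes "0 < T"
  shows "set_integrable lborel {0<..} (\<lambda>x. exp (x - x\<^sup>2 / (2 * T)))"
proof (rule set_integrable_bound[where f = "\<lambda>x. exp (2 * T) * exp (- x)"])
  show "set_borel_measurable lborel {0<..} (\<lambda>x. exp (x - x\<^sup>2 / (2 * T)))"
    by (intro set_borel_measurable_lborel continuous_intros) (use assms in auto)
qed (auto intro!: set_integrable_mult_right set_integrable_exp_minus exp_minus_square_le assms)

lemma Re_sabr_kernel_nonneg:
  assumes "t > 0"
  shows "0 \<le> Re (sabr_kernel (of_real x) t)"
proof -
  have "\<bar>x\<bar> \<le> sqrt (x\<^sup>2 + t)" using assms by (intro real_le_rsqrt) auto
  then have "cosh x \<le> cosh (sqrt (x\<^sup>2 + t))"
    using cosh_real_nonneg_le_iff[of "\<bar>x\<bar>" "sqrt (x\<^sup>2 + t)"] assms by simp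
  then show ?thesis
    using assms by (simp add: sabr_kernel_of_real)
qed

lemma sabr_kernel_real_le:
  assumes "t > 0" "0 \<le> x"
  shows "Re (sabr_kernel (of_real x) t) \<le> exp x * (exp (sqrt t) / sqrt t)"
  using norm_sabr_kernel_le[of "of_real x" 0 t] assms
      complex_Re_le_cmod[of "sabr_kernel (of_real x) t"]
  by (simp add: exp_add)

lemma sabr_integrand_le:
  fixes x T :: real
  assumes "t > 0" "0 \<le> x"
  shows "exp (- (x\<^sup>2 + t) / (2 * T)) * Re (sabr_kernel (of_real x) t) \<le>
    exp (x - x\<^sup>2 / (2 * T)) * (exp (- (1 / (2 * T)) * t) * (exp (sqrt t) / sqrt t))"
proof -
  have "exp (- (x\<^sup>2 + t) / (2 * T)) * Re (sabr_kernel (of_real x) t) \<le>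
      exp (- (x\<^sup>2 + t) / (2 * T)) * (exp x * (exp (sqrt t) / sqrt t))"
    using assms sabr_kernel_real_le[of t x] by (intro mult_left_mono) auto
  moreover have "exp (- (x\<^sup>2 + t) / (2 * T)) * exp x = exp (x - x\<^sup>2 / (2 * T)) *
      exp (- (1 / (2 * T)) * t)"
    by (simp add: add_divide_distrib diff_divide_distrib flip: exp_add)
  ultimately show ?thesis by (simp only: mult.assoc[symmetric])
qed

lemma continuous_on_sabr_kernel_line:
  assumes "\<bar>l\<bar> < pi / 2" "continuous_on A f" "continuous_on A g" "\<And>x. x \<in> A \<Longrightarrow> g x > 0"
  shows "continuous_on A (\<lambda>x. sabr_kernel (Complex (f x) l) (g x))"
  using assms by (intro continuous_on_sabr_kernel) (auto simp: Complex_eq intro!: continuous_intros)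

text \<open>For fixed \<open>x\<close> this is the substitution u = sqrt (x^2 + t), du = dt / (2u).
  Integrability is read off on the \<open>t\<close> side, where the kernel bound is at hand, and
  carried over to \<open>f\<close>, whose integrand is singular at u = x; nonnegativity of
  \<open>f\<close> makes this legitimate.\<close>

lemma
  fixes x T :: real
  assumes x: "0 \<le> x" and T: "0 < T"
  defines "f \<equiv> \<lambda>u. exp (- u\<^sup>2 / (2 * T)) * (sinh u / sqrt (cosh u - cosh x))"
    and "k \<equiv> \<lambda>t. exp (- (x\<^sup>2 + t) / (2 * T)) * Re (sabr_kernel (of_real x) t)"
  shows set_integrable_sabr_kernel: "set_integrable lborel {0<..} k"
    and set_integrable_volatility: "set_integrable lborel {x<..} f"
    and volatility_integral_eq: "(LBINT u:{x<..}. f u) = (LBINT t:{0<..}. k t)"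
proof -
  have kernel: "k t = f (sqrt (x\<^sup>2 + t)) * (1 / (2 * sqrt (x\<^sup>2 + t)))" if "0 < t" for t
    using that by (simp add: k_def f_def sabr_kernel_of_real add_nonneg_pos add_divide_distrib
        diff_divide_distrib)
  show int_k: "set_integrable lborel {0<..} k"
  proof (rule set_integrable_bound)
    show "set_integrable lborel {0<..} (\<lambda>t. exp (x - x\<^sup>2 / (2 * T)) *
        (exp (- (1 / (2 * T)) * t) * (exp (sqrt t) / sqrt t)))"
      using T by (intro set_integrable_mult_right set_integrable_exp_sqrt) auto
    show "set_borel_measurable lborel {0<..} k"
      unfolding k_def complex_of_real_def
      by (intro set_borel_measurable_lborel continuous_intros continuous_on_sabr_kernel_line)
          (use T in auto)
    show "AE t in lborel. t \<in> {0<..} \<longrightarrow> norm (k t) \<le>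
        norm (exp (x - x\<^sup>2 / (2 * T)) * (exp (- (1 / (2 * T)) * t) * (exp (sqrt t) / sqrt t)))"
      using x sabr_integrand_le[of _ x T] Re_sabr_kernel_nonneg[of _ x]
      by (intro AE_I2 impI) (simp add: k_def)
  qed
  have gt: "x < sqrt (x\<^sup>2 + t)" if "0 < t" for t using that x by (intro real_less_rsqrt) auto
  have subst: "set_integrable lborel (einterval x \<infinity>) f"
    "(LBINT u=x..\<infinity>. f u) = (LBINT t=0..\<infinity>. f (sqrt (x\<^sup>2 + t)) * (1 / (2 * sqrt (x\<^sup>2 + t))))"
  proof (rule_tac [!] interval_integral_substitution_nonneg)
    fix t :: real
    { assume t: "0 < ereal t"
      then have pos: "0 < x\<^sup>2 + t" by (simp add: add_nonneg_pos)
      then show "((\<lambda>t. sqrt (x\<^sup>2 + t)) has_field_derivative 1 / (2 * sqrt (x\<^sup>2 + t))) (at t)"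
        by (auto intro!: derivative_eq_intros simp: field_simps)
      then show "((\<lambda>t. sqrt (x\<^sup>2 + t)) has_field_derivative 1 / (2 * sqrt (x\<^sup>2 + t))) (at t)" .
      have "cosh x < cosh (sqrt (x\<^sup>2 + t))"
        using gt[of t] t x by (subst cosh_real_nonneg_less_iff) auto
      then show "isCont f (sqrt (x\<^sup>2 + t))"
        unfolding f_def using T gt[of t] t x by (intro continuous_intros) auto
      then show "isCont f (sqrt (x\<^sup>2 + t))" .
      show "isCont (\<lambda>t. 1 / (2 * sqrt (x\<^sup>2 + t))) t"
        using pos by (intro continuous_intros) auto
      then show "isCont (\<lambda>t. 1 / (2 * sqrt (x\<^sup>2 + t))) t" .
      show "0 \<le> f (sqrt (x\<^sup>2 + t))"
        unfolding f_def using \<open>cosh x < cosh (sqrt (x\<^sup>2 + t))\<close> pos by auto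
      then show "0 \<le> f (sqrt (x\<^sup>2 + t))" . }
    { assume t: "0 \<le> ereal t"
      then show "0 \<le> 1 / (2 * sqrt (x\<^sup>2 + t))" by simp
      then show "0 \<le> 1 / (2 * sqrt (x\<^sup>2 + t))" . }
  next
    show "set_integrable lborel (einterval 0 \<infinity>) (\<lambda>t. f (sqrt (x\<^sup>2 + t)) *
        (1 / (2 * sqrt (x\<^sup>2 + t))))"
      using int_k kernel by (subst set_integrable_cong[where f' = k])
        (auto simp: einterval_def greaterThan_def)
    then show "set_integrable lborel (einterval 0 \<infinity>) (\<lambda>t. f (sqrt (x\<^sup>2 + t)) *
        (1 / (2 * sqrt (x\<^sup>2 + t))))" .
    have "((\<lambda>t. sqrt (x\<^sup>2 + t)) \<longlongrightarrow> x) (at_right 0)"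
      using x by (auto intro!: tendsto_eq_intros)
    then have "((\<lambda>t. ereal (sqrt (x\<^sup>2 + t))) \<longlongrightarrow> ereal x) (at_right 0)" by simp
    then show "((ereal \<circ> (\<lambda>t. sqrt (x\<^sup>2 + t)) \<circ> real_of_ereal) \<longlongrightarrow> ereal x) (at_right 0)"
      unfolding zero_ereal_def ereal_tendsto_simps1 by (simp add: o_def)
    then show "((ereal \<circ> (\<lambda>t. sqrt (x\<^sup>2 + t)) \<circ> real_of_ereal) \<longlongrightarrow> ereal x) (at_right 0)" .
    have "filterlim (\<lambda>t. sqrt (x\<^sup>2 + t)) at_top at_top" by real_asymp
    then have "((\<lambda>t. ereal (sqrt (x\<^sup>2 + t))) \<longlongrightarrow> \<infinity>) at_top" by (simp add: tendsto_PInfty_eq_at_top)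
    then show "((ereal \<circ> (\<lambda>t. sqrt (x\<^sup>2 + t)) \<circ> real_of_ereal) \<longlongrightarrow> \<infinity>) (at_left \<infinity>)"
      unfolding ereal_tendsto_simps1 by (simp add: o_def)
    then show "((ereal \<circ> (\<lambda>t. sqrt (x\<^sup>2 + t)) \<circ> real_of_ereal) \<longlongrightarrow> \<infinity>) (at_left \<infinity>)" .
  qed auto
  show "set_integrable lborel {x<..} f"
    using subst(1) by (simp add: einterval_def greaterThan_def)
  have "(LBINT u:{x<..}. f u) = (LBINT t:{0<..}. f (sqrt (x\<^sup>2 + t)) * (1 / (2 * sqrt (x\<^sup>2 + t))))"
    using subst(2) by (simp only: zero_ereal_def interval_integral_to_infinity_eq)
  also have "\<dots> = (LBINT t:{0<..}. k t)"
    using kernel by (intro set_lebesgue_integral_cong) auto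
  finally show "(LBINT u:{x<..}. f u) = (LBINT t:{0<..}. k t)" .
qed

text \<open>Fubini's criterion with a majorant \<open>g\<close> in place of the iterated absolute
  integral, which need not be computed.\<close>

lemma integrable_lborel_pair:
  fixes f :: "real \<Rightarrow> real \<Rightarrow> real"
  assumes "case_prod f \<in> borel_measurable (lborel \<Otimes>\<^sub>M lborel)"
    and "\<And>x. integrable lborel (f x)"
    and "\<And>x. (LBINT y. \<bar>f x y\<bar>) \<le> g x" "integrable lborel g"
  shows "integrable (lborel \<Otimes>\<^sub>M lborel) (case_prod f)"
proof (rule lborel_pair.Fubini_integrable[OF assms(1)])
  show "integrable lborel (\<lambda>x. LBINT y. norm (case_prod f (x, y)))"
  proof (rule Bochner_Integration.integrable_bound[OF assms(4)])
    show "(\<lambda>x. LBINT y. norm (case_prod f (x, y))) \<in> borel_measurable lborel"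
      using assms(1) by measurable
    show "AE x in lborel. norm (LBINT y. norm (case_prod f (x, y))) \<le> norm (g x)"
    proof (rule AE_I2)
      fix x
      have "0 \<le> (LBINT y. \<bar>f x y\<bar>)" by (intro integral_nonneg_AE) auto
      then show "norm (LBINT y. norm (case_prod f (x, y))) \<le> norm (g x)"
        using assms(3)[of x] by simp
    qed
  qed
qed (use assms(2) in auto)

lemma abs_sin_mult_sinh_div_le:
  fixes r x :: real
  assumes "0 \<le> r" "0 < x"
  shows "\<bar>sin (r * sinh x) / sinh x\<bar> \<le> r"
  using abs_sin_x_le_abs_x[of "r * sinh x"] assms by (simp add: abs_mult field_simps)

lemma borel_measurable_cosh_sinh [measurable]:
  "(cosh :: real \<Rightarrow> real) \<in> borel_measurable borel" "(sinh :: real \<Rightarrow> real) \<in> borel_measurable borel"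
  by (intro borel_measurable_continuous_onI continuous_intros)+

text \<open>The substitution depends on \<open>x\<close>, so the \<open>u\<close>-integral has to
  become the inner one first: exchange on the wedge 0 < x < u, substitute for each \<open>x\<close>,
  and exchange back on the quadrant. The oscillating factor \<open>d\<close> is bounded by \<rho>,
  so both exchanges are absolutely convergent.\<close>

lemma sabr_integral_swap:
  fixes \<rho> T :: real
  assumes \<rho>: "0 \<le> \<rho>" and T: "0 < T"
  defines "d \<equiv> \<lambda>x. sin (\<rho> * sinh x) / sinh x"
  shows "(LBINT u:{0<..}. exp (- u\<^sup>2 / (2 * T)) * sabr_g (2 * \<rho>) u) =
    (LBINT t:{0<..}. LBINT x:{0<..}. d x * (exp (- (x\<^sup>2 + t) / (2 * T)) *
        Re (sabr_kernel (of_real x) t)))"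
proof -
  define f where "f x u = exp (- u\<^sup>2 / (2 * T)) * (sinh u / sqrt (cosh u - cosh x))" for x u
  define k where "k x t = exp (- (x\<^sup>2 + t) / (2 * T)) * Re (sabr_kernel (of_real x) t)" for x t
  define A where "A x u = (if 0 < x \<and> x < u then d x * f x u else 0)" for x u
  define B where "B x t = (if 0 < x \<and> 0 < t then d x * k x t else 0)" for x t
  define w where "w = (LBINT t:{0<..}. exp (- (1 / (2 * T)) * t) * (exp (sqrt t) / sqrt t))"
  \<comment> \<open>One majorant serves both exchanges, because \<open>A x\<close> and
    \<open>B x\<close> have the same absolute integral by the substitution.\<close>
  define g where "g x = indicator {0<..} x * (\<rho> * (exp (x - x\<^sup>2 / (2 * T)) * w))" for x :: real
  have f_nonneg: "0 \<le> f x u" if "0 < x" "x < u" for x u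
  proof -
    have "cosh x < cosh u" using that by (subst cosh_real_nonneg_less_iff) auto
    with that show ?thesis unfolding f_def by (intro mult_nonneg_nonneg divide_nonneg_nonneg) auto
  qed
  have k_nonneg: "0 \<le> k x t" if "0 < t" for x t
    using that Re_sabr_kernel_nonneg[of t x] by (simp add: k_def)
  have int_f: "set_integrable lborel {x<..} (f x)" and int_k: "set_integrable lborel {0<..} (k x)"
    and fk: "(LBINT u:{x<..}. f x u) = (LBINT t:{0<..}. k x t)" if "0 < x" for x
    unfolding f_def k_def using that T
    by (simp_all only: set_integrable_volatility set_integrable_sabr_kernel volatility_integral_eq
        less_imp_le)
  have k_le: "(LBINT t:{0<..}. k x t) \<le> exp (x - x\<^sup>2 / (2 * T)) * w" if "0 < x" for x
  proof -
    have "(LBINT t:{0<..}. k x t) \<le> (LBINT t:{0<..}. exp (x - x\<^sup>2 / (2 * T)) *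
        (exp (- (1 / (2 * T)) * t) * (exp (sqrt t) / sqrt t)))"
      using that T sabr_integrand_le[of _ x T]
      by (intro set_integral_mono int_k set_integrable_mult_right set_integrable_exp_sqrt)
          (auto simp: k_def)
    then show ?thesis unfolding w_def set_integral_mult_right .
  qed
  have int_g: "integrable lborel g"
    using set_integrable_mult_right[OF set_integrable_mult_left[OF
        set_integrable_exp_minus_square[OF T], of w], of \<rho>]
    by (simp add: g_def [abs_def] set_integrable_def)

  have A_eq: "A x = (\<lambda>u. indicator {x<..} u *\<^sub>R (d x * f x u))"
    and B_eq: "B x = (\<lambda>t. indicator {0<..} t *\<^sub>R (d x * k x t))" if "0 < x" for x
    using that by (auto simp: A_def B_def indicator_def)
  have abs_A: "\<bar>A x u\<bar> = indicator {x<..} u *\<^sub>R (\<bar>d x\<bar> * f x u)"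
    and abs_B: "\<bar>B x t\<bar> = indicator {0<..} t *\<^sub>R (\<bar>d x\<bar> * k x t)" if "0 < x" for x u t
    using that f_nonneg[of x u] k_nonneg[of t x] by (auto simp: A_def B_def indicator_def abs_mult)
  have zero: "A x = (\<lambda>_. 0)" "B x = (\<lambda>_. 0)" "g x = 0" if "\<not> 0 < x" for x
    using that by (auto simp: A_def B_def g_def)
  have int_AB: "integrable lborel (A x)" "integrable lborel (B x)" for x
    using set_integrable_mult_right[OF int_f[of x], of "d x"]
        set_integrable_mult_right[OF int_k[of x], of "d x"]
    by (cases "0 < x"; simp add: A_eq B_eq zero set_integrable_def)+
  have le: "\<bar>d x\<bar> * (LBINT t:{0<..}. k x t) \<le> g x" if "0 < x" for x
  proof -
    have "0 \<le> (LBINT t:{0<..}. k x t)"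
      unfolding set_lebesgue_integral_def using k_nonneg
      by (intro integral_nonneg_AE AE_I2) (auto simp: indicator_def)
    then have "\<bar>d x\<bar> * (LBINT t:{0<..}. k x t) \<le> \<rho> * (exp (x - x\<^sup>2 / (2 * T)) * w)"
      unfolding d_def using \<rho> that by (intro mult_mono abs_sin_mult_sinh_div_le k_le) auto
    then show ?thesis using that by (simp add: g_def)
  qed
  have norm_A: "(LBINT u. \<bar>A x u\<bar>) \<le> g x" for x
  proof (cases "0 < x")
    case True
    have "(LBINT u. \<bar>A x u\<bar>) = (LBINT u:{x<..}. \<bar>d x\<bar> * f x u)"
      unfolding abs_A[OF True] set_lebesgue_integral_def ..
    also have "\<dots> = \<bar>d x\<bar> * (LBINT t:{0<..}. k x t)"
      unfolding fk[OF True, symmetric] by (rule set_integral_mult_right)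
    finally show ?thesis using le[OF True] by simp
  qed (simp add: zero)
  have norm_B: "(LBINT t. \<bar>B x t\<bar>) \<le> g x" for x
  proof (cases "0 < x")
    case True
    have "(LBINT t. \<bar>B x t\<bar>) = (LBINT t:{0<..}. \<bar>d x\<bar> * k x t)"
      unfolding abs_B[OF True] set_lebesgue_integral_def ..
    also have "\<dots> = \<bar>d x\<bar> * (LBINT t:{0<..}. k x t)"
      by (rule set_integral_mult_right)
    finally show ?thesis using le[OF True] by simp
  qed (simp add: zero)

  have "case_prod A \<in> borel_measurable (lborel \<Otimes>\<^sub>M lborel)"
    unfolding A_def d_def f_def by measurable
  then have pair_A: "integrable (lborel \<Otimes>\<^sub>M lborel) (case_prod A)"
    by (rule integrable_lborel_pair[OF _ int_AB(1) norm_A int_g])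
  have "case_prod B \<in> borel_measurable borel"
  proof -
    let ?S = "{0<..} \<times> {0<..} :: (real \<times> real) set"
    have "continuous_on ?S (\<lambda>(x, t). d x * k x t)"
      unfolding d_def k_def complex_of_real_def case_prod_beta
      by (intro continuous_intros continuous_on_sabr_kernel_line) (use T in auto)
    moreover have "?S \<in> sets borel" by (intro borel_open open_Times) auto
    ultimately have "(\<lambda>p. indicator ?S p *\<^sub>R (case p of (x, t) \<Rightarrow> d x * k x t)) \<in> borel_measurable
        borel"
      by (intro borel_measurable_continuous_on_indicator)
    also have "(\<lambda>p. indicator ?S p *\<^sub>R (case p of (x, t) \<Rightarrow> d x * k x t)) = case_prod B"
      by (auto simp: B_def indicator_def fun_eq_iff)
    finally show ?thesis .
  qed
  then have pair_B: "integrable (lborel \<Otimes>\<^sub>M lborel) (case_prod B)"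
    by (intro integrable_lborel_pair[OF _ int_AB(2) norm_B int_g]) (simp add: lborel_prod)

  have "(LBINT u:{0<..}. exp (- u\<^sup>2 / (2 * T)) * sabr_g (2 * \<rho>) u) = (LBINT u. LBINT x. A x u)"
  proof -
    have "indicator {0<..} u *\<^sub>R (exp (- u\<^sup>2 / (2 * T)) * sabr_g (2 * \<rho>) u) = (LBINT x. A x u)"
        for u
    proof (cases "0 < u")
      case True
      have "exp (- u\<^sup>2 / (2 * T)) * sabr_g (2 * \<rho>) u =
        (LBINT x:{0<..<u}. exp (- u\<^sup>2 / (2 * T)) * sinh u * (1 / sqrt (cosh u - cosh x) * d x))"
        unfolding set_integral_mult_right sabr_g_def d_def by simp
      also have "\<dots> = (LBINT x. A x u)"
        unfolding set_lebesgue_integral_def A_def f_def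
        by (intro Bochner_Integration.integral_cong) (auto simp: indicator_def)
      finally show ?thesis using True by simp
    next
      case False
      then have "A x u = 0" for x by (auto simp: A_def)
      with False show ?thesis by simp
    qed
    then show ?thesis unfolding set_lebesgue_integral_def by simp
  qed
  also have "\<dots> = (LBINT x. LBINT u. A x u)"
    by (rule lborel_pair.Fubini_integral[OF pair_A])
  also have "\<dots> = (LBINT x. LBINT t. B x t)"
  proof (rule Bochner_Integration.integral_cong[OF refl])
    fix x :: real
    show "(LBINT u. A x u) = (LBINT t. B x t)"
    proof (cases "0 < x")
      case True
      have "(LBINT u. A x u) = (LBINT u:{x<..}. d x * f x u)"
        unfolding A_eq[OF True] set_lebesgue_integral_def ..
      also have "\<dots> = (LBINT t:{0<..}. d x * k x t)"
        unfolding set_integral_mult_right fk[OF True] ..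
      also have "\<dots> = (LBINT t. B x t)"
        unfolding B_eq[OF True] set_lebesgue_integral_def ..
      finally show ?thesis .
    qed (simp add: zero)
  qed
  also have "\<dots> = (LBINT t. LBINT x. B x t)"
    by (rule lborel_pair.Fubini_integral[OF pair_B, symmetric])
  also have "\<dots> = (LBINT t:{0<..}. LBINT x:{0<..}. d x * k x t)"
    unfolding set_lebesgue_integral_def B_def
    by (intro Bochner_Integration.integral_cong refl)
        (auto simp: indicator_def intro!: Bochner_Integration.integral_cong)
  finally show ?thesis unfolding k_def .
qed

text \<open>Undoing the substitution at s = 0 gives sinh u / sqrt (cosh u - 1) = sqrt 2 cosh (u/2),
  so the integral is Gaussian. The factor exp (T/8) comes from completing the square and later
  cancels the exp (-T/8) of the price formula.\<close>

lemma sabr_main_term: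
  fixes T :: real
  assumes T: "0 < T"
  shows "(LBINT t:{0<..}. exp (- t / (2 * T)) * Re (sabr_kernel 0 t)) = sqrt (pi * T) * exp (T / 8)"
proof -
  define G where "G u = exp (- u\<^sup>2 / (2 * T)) * cosh (u / 2)" for u :: real
  \<comment> \<open>Each half of cosh (u/2) shifts the Gaussian to mean T/2 or -T/2 at the cost of
    exp (T/8). The factor sqrt (2 pi T) / 2 undoes the normalisation of the densities and supplies
    the half in cosh.\<close>
  have "has_bochner_integral lborel (\<lambda>u. exp (T / 8) * sqrt (2 * pi * T) / 2 *
      (normal_density (T / 2) (sqrt T) u + normal_density (- T / 2) (sqrt T) u))
     (exp (T / 8) * sqrt (2 * pi * T) / 2 * (1 + 1))"
    using T by (intro has_bochner_integral_mult_right has_bochner_integral_add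
        has_bochner_integral_iff[THEN iffD2] conjI)
      (auto intro!: integrable_normal_density integral_normal_density)
  also have "(\<lambda>u. exp (T / 8) * sqrt (2 * pi * T) / 2 *
      (normal_density (T / 2) (sqrt T) u + normal_density (- T / 2) (sqrt T) u)) = G"
  proof
    fix u :: real
    have 1: "T / 8 - (u - T / 2)\<^sup>2 / (2 * T) = - u\<^sup>2 / (2 * T) + u / 2"
      and 2: "T / 8 - (u - - T / 2)\<^sup>2 / (2 * T) = - u\<^sup>2 / (2 * T) + - (u / 2)"
      using T by (simp_all add: power2_eq_square field_simps)
    have "exp (T / 8) * exp (- (u - T / 2)\<^sup>2 / (2 * T)) = exp (- u\<^sup>2 / (2 * T)) * exp (u / 2)"
      "exp (T / 8) * exp (- (u - - T / 2)\<^sup>2 / (2 * T)) = exp (- u\<^sup>2 / (2 * T)) * exp (- (u / 2))"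
      using 1 2 by (simp_all flip: exp_add)
    then show "exp (T / 8) * sqrt (2 * pi * T) / 2 *
        (normal_density (T / 2) (sqrt T) u + normal_density (- T / 2) (sqrt T) u) = G u"
      using T by (simp add: normal_density_def G_def cosh_def algebra_simps)
  qed
  finally have G: "has_bochner_integral lborel G (exp (T / 8) * sqrt (2 * pi * T))" by simp
  then have "set_integrable lborel {0..} G"
    unfolding set_integrable_def using integrable_mult_indicator[of "{0..}" lborel G]
    by (auto simp: has_bochner_integral_iff)
  then have "has_bochner_integral lborel (\<lambda>u. indicator {0..} u *\<^sub>R G u) (LBINT u:{0..}. G u)"
    by (simp add: has_bochner_integral_iff set_integrable_def set_lebesgue_integral_def)
  then have "has_bochner_integral lborel G (2 *\<^sub>R (LBINT u:{0..}. G u))"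
    by (rule has_bochner_integral_even_function) (simp add: G_def)
  with G have half: "exp (T / 8) * sqrt (2 * pi * T) = 2 *\<^sub>R (LBINT u:{0..}. G u)"
    by (rule has_bochner_integral_eq)
  have "(LBINT u:{0..}. G u) = (LBINT u:{0<..}. G u)"
    unfolding set_lebesgue_integral_def
    by (intro integral_cong_AE)
      (auto simp: indicator_def G_def intro!: AE_I'[of "{0}"] borel_measurable_continuous_onI)
  with half have G_int: "2 * (LBINT u:{0<..}. G u) = exp (T / 8) * sqrt (2 * pi * T)" by simp
  have "(LBINT t:{0<..}. exp (- t / (2 * T)) * Re (sabr_kernel 0 t)) =
      (LBINT u:{0<..}. exp (- u\<^sup>2 / (2 * T)) * (sinh u / sqrt (cosh u - 1)))"
    using volatility_integral_eq[of 0 T] T by simp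
  also have "\<dots> = (LBINT u:{0<..}. sqrt 2 * G u)"
  proof (intro set_lebesgue_integral_cong allI impI)
    fix u :: real assume u: "u \<in> {0<..}"
    have "cosh u = 2 * (sinh (u / 2))\<^sup>2 + 1" "sinh u = 2 * sinh (u / 2) * cosh (u / 2)"
      using cosh_double[of "u / 2"] sinh_double[of "u / 2"] cosh_square_eq[of "u / 2"] by simp_all
    then have "sinh u / sqrt (cosh u - 1) = sqrt 2 * cosh (u / 2)"
      using u by (simp add: real_sqrt_mult field_simps)
    then show "exp (- u\<^sup>2 / (2 * T)) * (sinh u / sqrt (cosh u - 1)) = sqrt 2 * G u"
      by (simp add: G_def)
  qed auto
  also have "\<dots> = sqrt 2 * (LBINT u:{0<..}. G u)" by (rule set_integral_mult_right)
  also have "\<dots> = sqrt 2 * (sqrt 2 * sqrt (pi * T) * exp (T / 8)) / 2"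
    using G_int by (simp add: real_sqrt_mult mult_ac)
  also have "\<dots> = sqrt (pi * T) * exp (T / 8)" by simp
  finally show ?thesis .
qed

subsection \<open>The remainder as an integral over the shifted contour\<close>

text \<open>The factor exp (- t / (2T)) is left out: it does not depend on \<open>x\<close> and
  serves as the weight of the outer integral.\<close>

definition shifted_integrand :: "real \<Rightarrow> real \<Rightarrow> real \<Rightarrow> real \<Rightarrow> real \<Rightarrow> complex" where
  "shifted_integrand \<rho> T l t x =
    (let s = Complex x l in
      exp (\<i> * of_real \<rho> * sinh s) * (exp (- s\<^sup>2 / of_real (2 * T)) * sabr_kernel s t) / sinh s)"

text \<open>Re (- s^2) = (Im s)^2 - (Re s)^2, so leaving the real axis costs the Gaussian at most
  exp (l^2 / (2T)). The bound is uniform over the whole half strip between the two contours, as the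
  contour shift demands.\<close>

lemma norm_gauss_sabr_kernel_le:
  assumes "0 \<le> Re s" "0 \<le> Im s" "Im s \<le> l" "l < pi / 2" "0 < t" "0 < T"
  shows "norm (exp (- s\<^sup>2 / of_real (2 * T)) * sabr_kernel s t) \<le>
    exp (l\<^sup>2 / (2 * T) + l) * exp (Re s - (Re s)\<^sup>2 / (2 * T)) * (exp (sqrt t) / sqrt (cos l * t))"
proof -
  have cos: "cos l > 0" using assms by (intro cos_gt_zero_pi) auto
  have "Re (- s\<^sup>2 / of_real (2 * T)) = (Im s)\<^sup>2 / (2 * T) - (Re s)\<^sup>2 / (2 * T)"
    by (simp add: Re_divide_of_real power2_eq_square diff_divide_distrib)
  also have "\<dots> \<le> l\<^sup>2 / (2 * T) - (Re s)\<^sup>2 / (2 * T)"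
    using assms by (intro diff_right_mono divide_right_mono power_mono) auto
  finally have 1: "norm (exp (- s\<^sup>2 / of_real (2 * T))) \<le> exp (l\<^sup>2 / (2 * T) - (Re s)\<^sup>2 / (2 * T))"
    unfolding norm_exp_eq_Re by simp
  have "norm s \<le> Re s + l" using cmod_le[of s] assms by simp
  then have "exp (norm s + sqrt t) \<le> exp (Re s + l + sqrt t)" by simp
  then have "exp (norm s + sqrt t) / sqrt (cos l * t) \<le> exp (Re s + l + sqrt t) / sqrt (cos l * t)"
    using cos assms by (intro divide_right_mono) auto
  moreover have "norm (sabr_kernel s t) \<le> exp (norm s + sqrt t) / sqrt (cos l * t)"
    using norm_sabr_kernel_le[of s l t] assms by simp
  ultimately have 2: "norm (sabr_kernel s t) \<le> exp (Re s + l + sqrt t) / sqrt (cos l * t)"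
    by linarith
  have "norm (exp (- s\<^sup>2 / of_real (2 * T)) * sabr_kernel s t) \<le>
      exp (l\<^sup>2 / (2 * T) - (Re s)\<^sup>2 / (2 * T)) * (exp (Re s + l + sqrt t) / sqrt (cos l * t))"
    unfolding norm_mult using 1 2 by (intro mult_mono) auto
  also have "\<dots> = exp (l\<^sup>2 / (2 * T) + l) * exp (Re s - (Re s)\<^sup>2 / (2 * T)) *
      (exp (sqrt t) / sqrt (cos l * t))"
    by (simp add: algebra_simps flip: exp_add)
  finally show ?thesis .
qed

lemma norm_exp_sinh_line_le:
  fixes \<rho> l x :: real
  assumes "0 \<le> \<rho>" "0 < l" "l < pi / 2"
  shows "norm (exp (\<i> * of_real \<rho> * sinh (Complex x l))) \<le> exp (- \<rho> * sin l)"
proof -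
  have "0 < sin l" using assms by (intro sin_gt_zero) auto
  then have "sin l * 1 \<le> sin l * cosh x" by (intro mult_left_mono cosh_real_ge_1) auto
  then have "\<rho> * (sin l * 1) \<le> \<rho> * (sin l * cosh x)" by (rule mult_left_mono) (rule assms)
  then show ?thesis by (simp add: Im_sinh mult_ac)
qed

text \<open>For T = \<tau>/\<rho> the first exponent is - \<rho> (sin l - l^2 / (2\<tau>)), which is
  already the exact decay rate. The remaining factors provide the majorant for dominated convergence
  after scaling.\<close>

lemma norm_shifted_integrand_le:
  assumes "0 \<le> \<rho>" "0 < l" "l < pi / 2" "0 < t" "0 < T" "0 \<le> x"
  shows "norm (shifted_integrand \<rho> T l t x) \<le>
    exp (- \<rho> * sin l + l\<^sup>2 / (2 * T)) * (exp l / (sin l * sqrt (cos l)) *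
        (exp (x - x\<^sup>2 / (2 * T)) * (exp (sqrt t) / sqrt t)))"
proof -
  have sin: "sin l > 0" using assms by (intro sin_gt_zero) auto
  have cos: "cos l > 0" using assms by (intro cos_gt_zero_pi) auto
  let ?s = "Complex x l"
  have "norm (shifted_integrand \<rho> T l t x) =
      norm (exp (\<i> * of_real \<rho> * sinh ?s)) * norm (exp (- ?s\<^sup>2 / of_real (2 * T)) *
          sabr_kernel ?s t) * norm (1 / sinh ?s)"
    by (simp add: shifted_integrand_def Let_def norm_mult norm_divide)
  also have "\<dots> \<le> exp (- \<rho> * sin l) *
      (exp (l\<^sup>2 / (2 * T) + l) * exp (x - x\<^sup>2 / (2 * T)) * (exp (sqrt t) / sqrt (cos l * t))) *
          (1 / sin l)"
    using norm_gauss_sabr_kernel_le[of ?s l t T] inverse_sinh_bound(2)[of l x] assms sin cos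
    by (intro mult_mono norm_exp_sinh_line_le) auto
  also have "\<dots> = exp (- \<rho> * sin l + l\<^sup>2 / (2 * T)) *
      (exp l / (sin l * sqrt (cos l)) * (exp (x - x\<^sup>2 / (2 * T)) * (exp (sqrt t) / sqrt t)))"
    by (simp only: exp_add real_sqrt_mult) (simp add: mult_ac)
  finally show ?thesis .
qed

lemma continuous_on_shifted_integrand:
  assumes "0 < l" "l < pi / 2" "0 < T" "continuous_on A f" "continuous_on A g" "\<And>x. x \<in> A \<Longrightarrow> g x > 0"
  shows "continuous_on A (\<lambda>p. shifted_integrand \<rho> T l (g p) (f p))"
proof -
  have sin: "sin l > 0" using assms by (intro sin_gt_zero) auto
  have "sinh (Complex x l) \<noteq> 0" for x
  proof -
    have "0 < \<bar>sin l\<bar> * cosh x" using sin by (intro mult_pos_pos) auto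
    with norm_sinh_ge(2)[of "Complex x l"] show ?thesis by auto
  qed
  moreover have "continuous_on A (\<lambda>p. Complex (f p) l)"
    unfolding Complex_eq by (intro continuous_intros assms)
  ultimately show ?thesis
    unfolding shifted_integrand_def Let_def using assms
    by (intro continuous_intros continuous_on_sabr_kernel_line) auto
qed

lemma borel_measurable_shifted_integrand:
  assumes "0 < l" "l < pi / 2" "0 < T"
  shows "(\<lambda>(t, x). indicator {0<..} t * (indicator {0<..} x * Im (shifted_integrand \<rho> T l t x))) \<in>
      borel_measurable (borel :: (real \<times> real) measure)"
proof -
  let ?S = "{0<..} \<times> {0<..} :: (real \<times> real) set"
  have "continuous_on ?S (\<lambda>p. Im (shifted_integrand \<rho> T l (fst p) (snd p)))"
    by (intro continuous_intros continuous_on_shifted_integrand assms) auto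
  moreover have "?S \<in> sets borel" by (intro borel_open open_Times) auto
  ultimately have "(\<lambda>p. indicator ?S p *\<^sub>R Im (shifted_integrand \<rho> T l (fst p) (snd p))) \<in>
      borel_measurable borel"
    by (intro borel_measurable_continuous_on_indicator)
  also have "(\<lambda>p. indicator ?S p *\<^sub>R Im (shifted_integrand \<rho> T l (fst p) (snd p))) =
      (\<lambda>(t, x). indicator {0<..} t * (indicator {0<..} x * Im (shifted_integrand \<rho> T l t x)))"
    by (auto simp: indicator_def fun_eq_iff)
  finally show ?thesis .
qed

lemma borel_measurable_integral_shifted_integrand:
  assumes "0 < l" "l < pi / 2" "0 < T"
  shows "(\<lambda>t. indicator {0<..} t * (LBINT x:{0<..}. Im (shifted_integrand \<rho> T l t x))) \<in>
      borel_measurable borel"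
proof -
  have "(\<lambda>(t, x). indicator {0<..} t * (indicator {0<..} x * Im (shifted_integrand \<rho> T l t x))) \<in>
      borel_measurable (borel \<Otimes>\<^sub>M lborel)"
    using borel_measurable_shifted_integrand[OF assms, of \<rho>]
    by (simp add: borel_prod[symmetric] cong: measurable_cong_sets)
  then have "(\<lambda>t. LBINT x. indicator {0<..} t *
      (indicator {0<..} x * Im (shifted_integrand \<rho> T l t x))) \<in> borel_measurable borel"
    by (rule lborel.borel_measurable_lebesgue_integral)
  then show ?thesis by (simp add: set_lebesgue_integral_def)
qed

lemma set_integrable_shifted_integrand:
  assumes "0 \<le> \<rho>" "0 < l" "l < pi / 2" "0 < t" "0 < T"
  shows "set_integrable lborel {0<..} (\<lambda>x. Im (shifted_integrand \<rho> T l t x))"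
proof (rule set_integrable_bound)
  let ?g = "\<lambda>x. exp (- \<rho> * sin l + l\<^sup>2 / (2 * T)) *
      (exp l / (sin l * sqrt (cos l)) * (exp (x - x\<^sup>2 / (2 * T)) * (exp (sqrt t) / sqrt t)))"
  show "set_integrable lborel {0<..} ?g"
    by (intro set_integrable_mult_right set_integrable_mult_left set_integrable_exp_minus_square
        assms)
  show "set_borel_measurable lborel {0<..} (\<lambda>x. Im (shifted_integrand \<rho> T l t x))"
    using assms
        by (intro set_borel_measurable_lborel continuous_intros continuous_on_shifted_integrand)
            auto
  show "AE x in lborel. x \<in> {0<..} \<longrightarrow> norm (Im (shifted_integrand \<rho> T l t x)) \<le> norm (?g x)"
  proof (intro AE_I2 impI)
    fix x :: real assume "x \<in> {0<..}"
    then have "norm (Im (shifted_integrand \<rho> T l t x)) \<le> ?g x"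
      using norm_shifted_integrand_le[OF assms, of x]
          abs_Im_le_cmod[of "shifted_integrand \<rho> T l t x"] by simp
    then show "norm (Im (shifted_integrand \<rho> T l t x)) \<le> norm (?g x)"
      by (rule order_trans) (simp only: real_norm_def abs_ge_self)
  qed
qed

lemma abs_integral_shifted_integrand_le:
  assumes "0 \<le> \<rho>" "0 < l" "l < pi / 2" "0 < t" "0 < T"
  shows "\<bar>LBINT x:{0<..}. Im (shifted_integrand \<rho> T l t x)\<bar> \<le>
    exp (- \<rho> * sin l + l\<^sup>2 / (2 * T)) * (exp l / (sin l * sqrt (cos l)) *
        ((LBINT x:{0<..}. exp (x - x\<^sup>2 / (2 * T))) * (exp (sqrt t) / sqrt t)))"
proof -
  let ?f = "\<lambda>x. Im (shifted_integrand \<rho> T l t x)"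
  let ?g = "\<lambda>x. exp (- \<rho> * sin l + l\<^sup>2 / (2 * T)) *
      (exp l / (sin l * sqrt (cos l)) * (exp (x - x\<^sup>2 / (2 * T)) * (exp (sqrt t) / sqrt t)))"
  have f: "set_integrable lborel {0<..} ?f" by (rule set_integrable_shifted_integrand[OF assms])
  have g: "set_integrable lborel {0<..} ?g"
    by (intro set_integrable_mult_right set_integrable_mult_left set_integrable_exp_minus_square
        assms)
  have le: "\<bar>?f x\<bar> \<le> ?g x" if "0 < x" for x
    using norm_shifted_integrand_le[OF assms, of x] abs_Im_le_cmod[of "shifted_integrand \<rho> T l t x"]
        that by simp
  have "\<bar>LBINT x:{0<..}. ?f x\<bar> \<le> (LBINT x:{0<..}. \<bar>?f x\<bar>)"
    using set_integral_norm_bound[OF f] by simp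
  also have "\<dots> \<le> (LBINT x:{0<..}. ?g x)"
    using le by (intro set_integral_mono g set_integrable_abs f) auto
  finally show ?thesis
    unfolding set_integral_mult_right set_integral_mult_left .
qed

text \<open>The contour is shifted for each fixed \<open>t\<close>, with Q the Gaussian times the
  kernel. The residue terms integrate to \<open>sabr_main_term\<close> and become the summand 1. The
  height \<open>l\<close> is arbitrary in (0, pi/2): the identity is exact, and the saddle point
  condition enters only in the asymptotics.\<close>

lemma sabr_atm_formula_eq:
  fixes \<rho> T l S0 :: real
  assumes \<rho>: "0 < \<rho>" and l: "0 < l" "l < pi / 2" and T: "0 < T"
  shows "sabr_atm_formula S0 (2 * \<rho>) T = S0 * (1 + 2 * exp (- T / 8) / (pi powr (3 / 2) * sqrt T) *
    (LBINT t:{0<..}. exp (- t / (2 * T)) * (LBINT x:{0<..}. Im (shifted_integrand \<rho> T l t x))))"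
proof -
  let ?J = "\<lambda>t. LBINT x:{0<..}. Im (shifted_integrand \<rho> T l t x)"
  have cos: "cos l > 0" using l by (intro cos_gt_zero_pi) auto
  have inner: "(LBINT x:{0<..}. sin (\<rho> * sinh x) / sinh x *
      (exp (- (x\<^sup>2 + t) / (2 * T)) * Re (sabr_kernel (of_real x) t))) =
      exp (- t / (2 * T)) * ?J t + pi / 2 * (exp (- t / (2 * T)) * Re (sabr_kernel 0 t))" if t: "0 <
          t" for t
  proof -
    define Q where "Q s = exp (- s\<^sup>2 / of_real (2 * T)) * sabr_kernel s t" for s
    have "(LBINT x:{0<..}. sin (\<rho> * sinh x) / sinh x *
        (exp (- (x\<^sup>2 + t) / (2 * T)) * Re (sabr_kernel (of_real x) t))) =
        (LBINT x:{0<..}. exp (- t / (2 * T)) * (sin (\<rho> * sinh x) / sinh x * Re (Q (of_real x))))"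
    proof (intro set_lebesgue_integral_cong allI impI)
      fix x :: real
      have "exp (- (of_real x)\<^sup>2 / complex_of_real (2 * T)) = of_real (exp (- x\<^sup>2 / (2 * T)))"
        by (simp flip: exp_of_real)
      then have "Re (Q (of_real x)) = exp (- x\<^sup>2 / (2 * T)) * Re (sabr_kernel (of_real x) t)"
        by (simp add: Q_def)
      moreover have "exp (- (x\<^sup>2 + t) / (2 * T)) = exp (- t / (2 * T)) * exp (- x\<^sup>2 / (2 * T))"
        by (simp add: diff_divide_distrib flip: exp_add)
      ultimately show "sin (\<rho> * sinh x) / sinh x *
          (exp (- (x\<^sup>2 + t) / (2 * T)) * Re (sabr_kernel (of_real x) t)) =
        exp (- t / (2 * T)) * (sin (\<rho> * sinh x) / sinh x * Re (Q (of_real x)))"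
        by simp
    qed auto
    also have "\<dots> = exp (- t / (2 * T)) * (LBINT x:{0<..}. sin (\<rho> * sinh x) / sinh x *
        Re (Q (of_real x)))"
      by (rule set_integral_mult_right)
    also have "(LBINT x:{0<..}. sin (\<rho> * sinh x) / sinh x * Re (Q (of_real x))) =
        (LBINT x:{0<..}. Im (exp (\<i> * of_real \<rho> * sinh (Complex x l)) *
            Q (Complex x l) / sinh (Complex x l))) + pi / 2 * Re (Q 0)"
    proof (rule contour_shift[OF \<rho> l])
      show "Q holomorphic_on {s. \<bar>Im s\<bar> < pi / 2}"
        unfolding Q_def using T t by (intro holomorphic_intros holomorphic_on_sabr_kernel) auto
      show "Q s \<in> \<real>" if "\<bar>Im s\<bar> < pi / 2" "s\<^sup>2 \<in> \<real>" for s
      proof -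
        from that(2) obtain v where v: "s\<^sup>2 = of_real v" by (elim Reals_cases)
        have "exp (- s\<^sup>2 / of_real (2 * T)) = of_real (exp (- v / (2 * T)))"
          unfolding v by (simp flip: exp_of_real)
        then show ?thesis
          unfolding Q_def using sabr_kernel_in_Reals[OF that(1) t that(2)]
              by (metis Reals_mult Reals_of_real)
      qed
      fix s :: complex assume s: "0 \<le> Re s" "0 \<le> Im s" "Im s \<le> l"
      have "norm (Q s) \<le> exp (l\<^sup>2 / (2 * T) + l) * exp (Re s - (Re s)\<^sup>2 / (2 * T)) *
          (exp (sqrt t) / sqrt (cos l * t))"
        unfolding Q_def by (rule norm_gauss_sabr_kernel_le[OF s l(2) t T])
      also have "\<dots> \<le> exp (l\<^sup>2 / (2 * T) + l) * (exp (2 * T) * exp (- Re s)) *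
          (exp (sqrt t) / sqrt (cos l * t))"
        using t cos T by (intro mult_right_mono mult_left_mono exp_minus_square_le) auto
      finally show "norm (Q s) \<le> exp (l\<^sup>2 / (2 * T) + l) * exp (2 * T) *
          (exp (sqrt t) / sqrt (cos l * t)) * exp (- Re s)"
        by (simp only: mult_ac)
    qed
    finally show ?thesis
      by (simp add: shifted_integrand_def Let_def Q_def algebra_simps)
  qed
  have int_J: "set_integrable lborel {0<..} (\<lambda>t. exp (- t / (2 * T)) * ?J t)"
  proof (rule set_integrable_bound)
    define c where "c = exp (- \<rho> * sin l + l\<^sup>2 / (2 * T)) *
        (exp l / (sin l * sqrt (cos l)) * (LBINT x:{0<..}. exp (x - x\<^sup>2 / (2 * T))))"
    show "set_integrable lborel {0<..} (\<lambda>t. c *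
        (exp (- (1 / (2 * T)) * t) * (exp (sqrt t) / sqrt t)))"
      using T by (intro set_integrable_mult_right set_integrable_exp_sqrt) auto
    have "(\<lambda>t. exp (- t / (2 * T)) * (indicator {0<..} t * ?J t)) \<in> borel_measurable borel"
      using borel_measurable_integral_shifted_integrand[OF l T, of \<rho>] by measurable
    then show "set_borel_measurable lborel {0<..} (\<lambda>t. exp (- t / (2 * T)) * ?J t)"
      by (simp add: set_borel_measurable_def mult_ac)
    show "AE t in lborel. t \<in> {0<..} \<longrightarrow> norm (exp (- t / (2 * T)) * ?J t) \<le>
        norm (c * (exp (- (1 / (2 * T)) * t) * (exp (sqrt t) / sqrt t)))"
    proof (intro AE_I2 impI)
      fix t :: real assume t: "t \<in> {0<..}"
      have "norm (exp (- t / (2 * T)) * ?J t) \<le> exp (- t / (2 * T)) * (c * (exp (sqrt t) / sqrt t))"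
        unfolding real_norm_def abs_mult abs_exp_cancel c_def using t \<rho> l T
        by (intro mult_left_mono order_trans[OF abs_integral_shifted_integrand_le])
            (auto simp: mult.assoc)
      also have "\<dots> = c * (exp (- (1 / (2 * T)) * t) * (exp (sqrt t) / sqrt t))"
        by (simp add: mult_ac)
      also have "\<dots> \<le> norm (c * (exp (- (1 / (2 * T)) * t) * (exp (sqrt t) / sqrt t)))"
        by (simp only: real_norm_def abs_ge_self)
      finally show "norm (exp (- t / (2 * T)) * ?J t) \<le>
          norm (c * (exp (- (1 / (2 * T)) * t) * (exp (sqrt t) / sqrt t)))" .
    qed
  qed
  have int_main: "set_integrable lborel {0<..} (\<lambda>t. pi / 2 *
      (exp (- t / (2 * T)) * Re (sabr_kernel 0 t)))"
    using set_integrable_sabr_kernel[of 0 T] T by (intro set_integrable_mult_right) simp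
  have "(LBINT u:{0<..}. exp (- u\<^sup>2 / (2 * T)) * sabr_g (2 * \<rho>) u) =
      (LBINT t:{0<..}. exp (- t / (2 * T)) * ?J t + pi / 2 *
          (exp (- t / (2 * T)) * Re (sabr_kernel 0 t)))"
    using inner \<rho> T by (subst sabr_integral_swap) (auto intro!: set_lebesgue_integral_cong)
  also have "\<dots> = (LBINT t:{0<..}. exp (- t / (2 * T)) * ?J t) + pi / 2 *
      (sqrt (pi * T) * exp (T / 8))"
    unfolding set_integral_add(2)[OF int_J int_main] sabr_main_term[OF T, symmetric]
    by (simp only: set_integral_mult_right)
  finally have eq: "(LBINT u:{0<..}. exp (- u\<^sup>2 / (2 * T)) * sabr_g (2 * \<rho>) u) =
     (LBINT t:{0<..}. exp (- t / (2 * T)) * ?J t) + pi / 2 * (sqrt (pi * T) * exp (T / 8))" .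
  have "pi powr (3 / 2) = pi powr (1 + 1 / 2)" by simp
  also have "\<dots> = pi * sqrt pi" unfolding powr_add by (simp add: powr_half_sqrt)
  finally have pi: "pi powr (3 / 2) = pi * sqrt pi" .
  have "2 * exp (- T / 8) / (pi powr (3 / 2) * sqrt T) * (pi / 2 * (sqrt (pi * T) * exp (T / 8))) =
      exp (- T / 8) * exp (T / 8)"
    unfolding pi using T by (simp add: real_sqrt_mult)
  then have one: "2 * exp (- T / 8) / (pi powr (3 / 2) * sqrt T) *
      (pi / 2 * (sqrt (pi * T) * exp (T / 8))) = 1"
    by (simp flip: exp_add)
  have "sabr_atm_formula S0 (2 * \<rho>) T = S0 * (2 * exp (- T / 8) / (pi powr (3 / 2) * sqrt T) *
      ((LBINT t:{0<..}. exp (- t / (2 * T)) * ?J t) + pi / 2 * (sqrt (pi * T) * exp (T / 8))))"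
    unfolding sabr_atm_formula_def eq by simp
  then show ?thesis
    unfolding distrib_left one by (simp add: algebra_simps)
qed

subsection \<open>Laplace asymptotics at the saddle point\<close>

lemma set_integral_scale_pos:
  fixes f :: "real \<Rightarrow> real"
  assumes "0 < c"
  shows "(LBINT x:{0<..}. f x) = c * (LBINT x:{0<..}. f (c * x))"
proof -
  have "(LBINT x:{0<..}. f x) = c * (LBINT x. indicator {0<..} (c * x) *\<^sub>R f (c * x))"
    using lborel_integral_real_affine[of c "\<lambda>x. indicator {0<..} x *\<^sub>R f x" 0] assms
    by (simp add: set_lebesgue_integral_def)
  also have "(\<lambda>x. indicator {0<..} (c * x) *\<^sub>R f (c * x)) = (\<lambda>x. indicator {0<..} x *\<^sub>R f (c * x))"
    using assms by (auto simp: indicator_def zero_less_mult_iff fun_eq_iff)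
  finally show ?thesis by (simp add: set_lebesgue_integral_def)
qed

lemma set_integral_pos_greaterThan:
  fixes f :: "real \<Rightarrow> real"
  assumes "set_integrable lborel {0<..} f" "\<And>x. 0 < x \<Longrightarrow> 0 < f x"
  shows "0 < (LBINT x:{0<..}. f x)"
proof -
  let ?g = "\<lambda>x. indicator {0<..} x *\<^sub>R f x"
  have nonneg: "0 \<le> ?g x" for x using assms(2)[of x] by (auto simp: indicator_def)
  have "(LBINT x. ?g x) \<noteq> 0"
  proof
    assume "(LBINT x. ?g x) = 0"
    then have "AE x in lborel. ?g x = 0"
      using assms(1) nonneg by (subst (asm) integral_nonneg_eq_0_iff_AE)
          (auto simp: set_integrable_def)
    then have "AE x in lborel. x \<notin> {0<..<1::real}"
      by eventually_elim (use assms(2) in \<open>force simp: indicator_def\<close>)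
    then have "emeasure lborel {0<..<1::real} = 0"
      by (subst (asm) AE_iff_measurable[of "{0<..<1}"]) auto
    moreover have "emeasure lborel {0<..<1::real} = 1"
      by (subst emeasure_lborel_Ioo) auto
    ultimately show False by (metis zero_neq_one)
  qed
  moreover have "0 \<le> (LBINT x. ?g x)" using nonneg by (intro integral_nonneg_AE) auto
  ultimately show ?thesis by (simp add: set_lebesgue_integral_def)
qed

text \<open>Strict differentiability: both points move. Subtracting the linear function with slope
  \<open>f' v0\<close> leaves a derivative that is small near \<open>v0\<close>, and the mean value
  bound applies on a ball. In the kernel the base point \<open>s\<^sup>2\<close> moves together with
  the step \<open>t\<close>.\<close>

lemma difference_quotient_tendsto:
  fixes f f' :: "complex \<Rightarrow> complex"
  assumes f: "\<And>v. (f has_field_derivative f' v) (at v)" and cont: "isCont f' v0"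
    and u: "(u \<longlongrightarrow> v0) F" and w: "(w \<longlongrightarrow> v0) F" and ne: "\<forall>\<^sub>F x in F. u x \<noteq> w x"
  shows "((\<lambda>x. (f (u x) - f (w x)) / (u x - w x)) \<longlongrightarrow> f' v0) F"
proof (rule tendstoI)
  fix e :: real assume e: "0 < e"
  obtain r where r: "0 < r" "\<And>v. dist v v0 < r \<Longrightarrow> dist (f' v) (f' v0) < e / 2"
    using cont e unfolding continuous_at_eps_delta by (meson half_gt_zero)
  have "\<forall>\<^sub>F x in F. dist (u x) v0 < r" "\<forall>\<^sub>F x in F. dist (w x) v0 < r"
    using tendstoD[OF u r(1)] tendstoD[OF w r(1)] .
  with ne show "\<forall>\<^sub>F x in F. dist ((f (u x) - f (w x)) / (u x - w x)) (f' v0) < e"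
  proof eventually_elim
    case (elim x)
    have "norm ((f (u x) - u x * f' v0) - (f (w x) - w x * f' v0)) \<le> e / 2 * norm (u x - w x)"
    proof (rule field_differentiable_bound[of "ball v0 r" "\<lambda>v. f v - v * f' v0" "\<lambda>v. f' v - f' v0"])
      fix v assume "v \<in> ball v0 r"
      then show "norm (f' v - f' v0) \<le> e / 2"
        using r(2)[of v] by (simp add: dist_norm norm_minus_commute)
      have "((\<lambda>v. f v - v * f' v0) has_field_derivative f' v - 1 * f' v0) (at v within ball v0 r)"
        by (intro DERIV_diff DERIV_cmult_right DERIV_ident has_field_derivative_at_within[OF f])
      then show "((\<lambda>v. f v - v * f' v0) has_field_derivative f' v - f' v0) (at v within ball v0 r)"
        by simp
    qed (use elim in \<open>auto simp: dist_commute\<close>)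
    moreover have "(f (u x) - f (w x)) / (u x - w x) - f' v0 =
        ((f (u x) - u x * f' v0) - (f (w x) - w x * f' v0)) / (u x - w x)"
      using elim by (simp add: field_simps)
    ultimately have "norm ((f (u x) - f (w x)) / (u x - w x) - f' v0) \<le> e / 2"
      using elim by (simp add: norm_divide divide_le_eq)
    then show ?case using e by (simp add: dist_norm)
  qed
qed

lemma csqrt_of_real_mult:
  assumes "0 < t"
  shows "csqrt (of_real t * z) = of_real (sqrt t) * csqrt z"
proof (rule csqrt_unique)
  show "(of_real (sqrt t) * csqrt z)\<^sup>2 = of_real t * z"
    using assms by (simp add: power_mult_distrib flip: of_real_power)
  show "0 < Re (of_real (sqrt t) * csqrt z) \<or> Re (of_real (sqrt t) * csqrt z) = 0 \<and> 0 \<le>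
      Im (of_real (sqrt t) * csqrt z)"
    using csqrt_principal[of z] assms by auto
qed

text \<open>Pulling sqrt t out of the root turns the radicand into a difference quotient. Numerator
  and quotient both tend to q = sin l / (2l), the derivative of \<open>cosh_root\<close> at -l^2,
  and q / sqrt q = sqrt q.\<close>

lemma sabr_kernel_tendsto:
  assumes s: "(s \<longlongrightarrow> \<i> * of_real l) F" and t: "(t \<longlongrightarrow> 0) F" "\<forall>\<^sub>F x in F. 0 < t x"
    and l: "0 < l" "l < pi / 2"
  shows "((\<lambda>x. of_real (sqrt (t x)) * sabr_kernel (s x) (t x)) \<longlongrightarrow> of_real (sqrt (sin l / (2 * l))))
      F"
proof -
  define q where "q = sin l / (2 * l)"
  have "sin l > 0" using l by (intro sin_gt_zero) auto
  then have q: "0 < q" using l by (simp add: q_def)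
  let ?v = "(\<i> * of_real l)\<^sup>2"
  have "sinh (\<i> * of_real l) = \<i> * of_real (sin l)"
    by (simp add: complex_eq_iff Re_sinh Im_sinh)
  then have dq: "deriv cosh_root ?v = of_real q"
    using deriv_cosh_root_square[of "\<i> * of_real l"] l by (simp add: q_def field_simps)
  have cont: "isCont (deriv cosh_root) v" for v
    using holomorphic_on_imp_continuous_on[OF
        holomorphic_on_deriv_cosh_root[OF holomorphic_on_ident, of UNIV]]
    by (simp add: continuous_on_eq_continuous_at)
  have v: "((\<lambda>x. (s x)\<^sup>2) \<longlongrightarrow> ?v) F" by (intro tendsto_intros s)
  have vt: "((\<lambda>x. (s x)\<^sup>2 + of_real (t x)) \<longlongrightarrow> ?v) F"
    using tendsto_add[OF v tendsto_of_real[OF t(1)]] by simp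
  let ?R = "\<lambda>x. (cosh_root ((s x)\<^sup>2 + of_real (t x)) - cosh_root ((s x)\<^sup>2)) / of_real (t x)"
  have "((\<lambda>x. (cosh_root ((s x)\<^sup>2 + of_real (t x)) - cosh_root ((s x)\<^sup>2)) / ((s x)\<^sup>2 +
      of_real (t x) - (s x)\<^sup>2)) \<longlongrightarrow> deriv cosh_root ?v) F"
    using t(2) by (intro difference_quotient_tendsto DERIV_cosh_root cont vt v)
        (auto elim!: eventually_mono)
  then have "(?R \<longlongrightarrow> of_real q) F"
    unfolding dq by simp
  then have "((\<lambda>x. csqrt (?R x)) \<longlongrightarrow> csqrt (of_real q)) F"
    using q by (intro isCont_tendsto_compose[OF continuous_at_csqrt])
        (auto simp: complex_nonpos_Reals_iff)
  moreover have "((\<lambda>x. deriv cosh_root ((s x)\<^sup>2 + of_real (t x))) \<longlongrightarrow> of_real q) F"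
    using isCont_tendsto_compose[OF cont vt] unfolding dq .
  ultimately have "((\<lambda>x. deriv cosh_root ((s x)\<^sup>2 + of_real (t x)) / csqrt (?R x)) \<longlongrightarrow>
      of_real q / csqrt (of_real q)) F"
    using q by (intro tendsto_divide) auto
  also have "of_real q / csqrt (of_real q) = complex_of_real (sqrt q)"
    using q by (simp add: csqrt_of_real real_div_sqrt flip: of_real_divide)
  finally have *: "((\<lambda>x. deriv cosh_root ((s x)\<^sup>2 + of_real (t x)) / csqrt (?R x)) \<longlongrightarrow>
      complex_of_real (sqrt q)) F" .
  have "\<forall>\<^sub>F x in F. deriv cosh_root ((s x)\<^sup>2 + of_real (t x)) / csqrt (?R x) =
      of_real (sqrt (t x)) * sabr_kernel (s x) (t x)"
    using t(2)
  proof eventually_elim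
    case (elim x)
    have "csqrt (cosh_root ((s x)\<^sup>2 + of_real (t x)) - cosh_root ((s x)\<^sup>2)) = of_real (sqrt (t x)) *
        csqrt (?R x)"
      using elim csqrt_of_real_mult[OF elim, of "?R x"] by simp
    then show ?case
      using elim unfolding sabr_kernel_def by simp
  qed
  from Lim_transform_eventually[OF * this] show ?thesis unfolding q_def .
qed

text \<open>The exponential removes the expected decay. The factor 1 / sqrt \<rho> is the Jacobian
  of the \<open>x\<close>-scaling, and it is just what the kernel's 1 / sqrt t singularity at t =
  z/\<rho> needs for a finite nonzero limit.\<close>

definition scaled_integrand :: "real \<Rightarrow> real \<Rightarrow> real \<Rightarrow> real \<Rightarrow> real \<Rightarrow> real" where
  "scaled_integrand \<tau> l \<rho> z x =
    exp (\<rho> * (sin l - l\<^sup>2 / (2 * \<tau>))) / sqrt \<rho> *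
        Im (shifted_integrand \<rho> (\<tau> / \<rho>) l (z / \<rho>) (x / sqrt \<rho>))"

lemma shifted_integral_scaled:
  assumes "0 < \<rho>" "0 < \<tau>"
  shows "(LBINT t:{0<..}. exp (- t / (2 * (\<tau> / \<rho>))) *
      (LBINT x:{0<..}. Im (shifted_integrand \<rho> (\<tau> / \<rho>) l t x))) =
    exp (- \<rho> * (sin l - l\<^sup>2 / (2 * \<tau>))) / \<rho> *
      (LBINT z:{0<..}. exp (- z / (2 * \<tau>)) * (LBINT x:{0<..}. scaled_integrand \<tau> l \<rho> z x))"
proof -
  let ?E = "exp (\<rho> * (sin l - l\<^sup>2 / (2 * \<tau>)))"
  have x: "(LBINT x:{0<..}. Im (shifted_integrand \<rho> (\<tau> / \<rho>) l t x)) =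
      1 / ?E * (LBINT x:{0<..}. scaled_integrand \<tau> l \<rho> (\<rho> * t) x)" for t
  proof -
    have "(LBINT x:{0<..}. Im (shifted_integrand \<rho> (\<tau> / \<rho>) l t x)) =
        1 / sqrt \<rho> * (LBINT x:{0<..}. Im (shifted_integrand \<rho> (\<tau> / \<rho>) l t (1 / sqrt \<rho> * x)))"
      using assms by (intro set_integral_scale_pos) auto
    also have "\<dots> = 1 / ?E * (LBINT x:{0<..}. scaled_integrand \<tau> l \<rho> (\<rho> * t) x)"
      unfolding scaled_integrand_def set_integral_mult_right using assms by simp
    finally show ?thesis .
  qed
  have "(LBINT t:{0<..}. exp (- t / (2 * (\<tau> / \<rho>))) *
      (LBINT x:{0<..}. Im (shifted_integrand \<rho> (\<tau> / \<rho>) l t x))) =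
      1 / \<rho> * (LBINT z:{0<..}. exp (- (1 / \<rho> * z) / (2 * (\<tau> / \<rho>))) *
          (1 / ?E * (LBINT x:{0<..}. scaled_integrand \<tau> l \<rho> (\<rho> * (1 / \<rho> * z)) x)))"
    unfolding x using assms by (intro set_integral_scale_pos) auto
  also have "\<dots> = 1 / \<rho> * (LBINT z:{0<..}. 1 / ?E *
      (exp (- z / (2 * \<tau>)) * (LBINT x:{0<..}. scaled_integrand \<tau> l \<rho> z x)))"
    using assms by (simp add: mult_ac)
  also have "\<dots> = 1 / \<rho> * (1 / ?E * (LBINT z:{0<..}. exp (- z / (2 * \<tau>)) *
      (LBINT x:{0<..}. scaled_integrand \<tau> l \<rho> z x)))"
    by (simp only: set_integral_mult_right)
  also have "1 / ?E = exp (- \<rho> * (sin l - l\<^sup>2 / (2 * \<tau>)))"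
    by (simp only: mult_minus_left exp_minus inverse_eq_divide)
  finally show ?thesis by simp
qed

text \<open>The Gaussian exponent x^2 / (2\<tau>) is invariant under the scaling, since T =
  \<tau>/\<rho>. With \<rho> \<ge> 1 the other growing arguments only shrink, so the bound is free
  of \<rho>.\<close>

lemma abs_scaled_integrand_le:
  assumes "1 \<le> \<rho>" "0 < \<tau>" "0 < l" "l < pi / 2" "0 < z" "0 < x"
  shows "\<bar>scaled_integrand \<tau> l \<rho> z x\<bar> \<le>
    exp l / (sin l * sqrt (cos l)) * (exp (x - x\<^sup>2 / (2 * \<tau>)) * (exp (sqrt z) / sqrt z))"
proof -
  have sin: "sin l > 0" using assms by (intro sin_gt_zero) auto
  have cos: "cos l > 0" using assms by (intro cos_gt_zero_pi) auto
  let ?E = "\<rho> * (sin l - l\<^sup>2 / (2 * \<tau>))" and ?c = "exp l / (sin l * sqrt (cos l))"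
  have "\<bar>Im (shifted_integrand \<rho> (\<tau> / \<rho>) l (z / \<rho>) (x / sqrt \<rho>))\<bar> \<le>
     exp (- \<rho> * sin l + l\<^sup>2 / (2 * (\<tau> / \<rho>))) *
         (?c * (exp (x / sqrt \<rho> - (x / sqrt \<rho>)\<^sup>2 / (2 * (\<tau> / \<rho>))) *
             (exp (sqrt (z / \<rho>)) / sqrt (z / \<rho>))))"
    using assms by (intro order_trans[OF abs_Im_le_cmod norm_shifted_integrand_le]) auto
  also have "- \<rho> * sin l + l\<^sup>2 / (2 * (\<tau> / \<rho>)) = - ?E"
    using assms by (simp add: field_simps)
  also have "(x / sqrt \<rho>)\<^sup>2 / (2 * (\<tau> / \<rho>)) = x\<^sup>2 / (2 * \<tau>)"
    using assms by (simp add: power_divide)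
  also have "exp (- ?E) * (?c * (exp (x / sqrt \<rho> - x\<^sup>2 / (2 * \<tau>)) *
      (exp (sqrt (z / \<rho>)) / sqrt (z / \<rho>)))) \<le>
      exp (- ?E) * (?c * (exp (x - x\<^sup>2 / (2 * \<tau>)) * (exp (sqrt z) / sqrt (z / \<rho>))))"
  proof -
    have "x / sqrt \<rho> \<le> x / 1" "z / \<rho> \<le> z / 1" using assms by (intro divide_left_mono; simp)+
    then show ?thesis
      using assms sin cos by (intro mult_left_mono mult_mono divide_right_mono) auto
  qed
  finally have le: "\<bar>Im (shifted_integrand \<rho> (\<tau> / \<rho>) l (z / \<rho>) (x / sqrt \<rho>))\<bar> \<le> exp (- ?E) *
      (?c * (exp (x - x\<^sup>2 / (2 * \<tau>)) * (exp (sqrt z) / sqrt (z / \<rho>))))" .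
  have "\<bar>scaled_integrand \<tau> l \<rho> z x\<bar> = exp ?E / sqrt \<rho> *
      \<bar>Im (shifted_integrand \<rho> (\<tau> / \<rho>) l (z / \<rho>) (x / sqrt \<rho>))\<bar>"
    using assms by (simp add: scaled_integrand_def abs_mult)
  also have "\<dots> \<le> exp ?E / sqrt \<rho> * (exp (- ?E) *
      (?c * (exp (x - x\<^sup>2 / (2 * \<tau>)) * (exp (sqrt z) / sqrt (z / \<rho>)))))"
    using le assms by (intro mult_left_mono) auto
  also have "\<dots> = (exp ?E * exp (- ?E)) * (?c *
      (exp (x - x\<^sup>2 / (2 * \<tau>)) * (exp (sqrt z) / (sqrt \<rho> * sqrt (z / \<rho>)))))"
    by (simp only: times_divide_eq_left times_divide_eq_right divide_divide_eq_left mult_ac)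
  also have "sqrt \<rho> * sqrt (z / \<rho>) = sqrt z"
    using assms by (simp flip: real_sqrt_mult)
  also have "exp ?E * exp (- ?E) = 1"
    by (simp flip: exp_add)
  finally show ?thesis by simp
qed

text \<open>With a = x / sqrt \<rho>, the exponent relative to its saddle value is - sin l \<rho>
  (cosh a - 1) - x^2 / (2\<tau>) + i cos l \<rho> (sinh a - a). The first term tends to - sin l x^2
  / 2; the phase is of order a^3 \<rho> and vanishes. The minus sign of the limit comes from 1 /
  sinh (il) = -i / sin l.\<close>

lemma scaled_integrand_tendsto:
  assumes \<tau>: "0 < \<tau>" and l: "0 < l" "l < pi / 2" "l = \<tau> * cos l" and x: "0 < x" and z: "0 < z"
  shows "((\<lambda>\<rho>. scaled_integrand \<tau> l \<rho> z x) \<longlongrightarrow>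
    - (sqrt (sin l / (2 * l)) / sin l) * (exp (- (sin l / 2 + 1 / (2 * \<tau>)) * x\<^sup>2) * (1 / sqrt z)))
        at_top"
proof -
  define q where "q = sin l / (2 * l)"
  define \<alpha> where "\<alpha> = sin l / 2 + 1 / (2 * \<tau>)"
  define a where "a \<rho> = x / sqrt \<rho>" for \<rho>
  define s where "s \<rho> = Complex (a \<rho>) l" for \<rho>
  have sin: "sin l > 0" using l by (intro sin_gt_zero) auto
  have a: "(a \<longlongrightarrow> 0) at_top" unfolding a_def using x by real_asymp
  have "((\<lambda>\<rho>. of_real (a \<rho>) + \<i> * of_real l) \<longlongrightarrow> of_real 0 + \<i> * of_real l) at_top"
    by (intro tendsto_intros a)
  then have s: "(s \<longlongrightarrow> \<i> * of_real l) at_top" by (simp add: s_def [abs_def] Complex_eq)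
  have t: "((\<lambda>\<rho>. z / \<rho>) \<longlongrightarrow> 0) at_top" using z by real_asymp
  have t_pos: "\<forall>\<^sub>F \<rho> in at_top. 0 < z / \<rho>"
    using eventually_gt_at_top[of "0::real"] by eventually_elim (use z in auto)
  note kernel = sabr_kernel_tendsto[OF s t t_pos l(1,2), folded q_def]
  have "((\<lambda>\<rho>. \<rho> * (cosh (a \<rho>) - 1)) \<longlongrightarrow> x * x / 2) at_top"
    unfolding a_def using x by real_asymp
  then have "((\<lambda>\<rho>. - sin l * (\<rho> * (cosh (a \<rho>) - 1)) - x\<^sup>2 / (2 * \<tau>)) \<longlongrightarrow> - sin l *
      (x\<^sup>2 / 2) - x\<^sup>2 / (2 * \<tau>)) at_top"
    unfolding power2_eq_square by (intro tendsto_intros)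
  moreover have "((\<lambda>\<rho>. \<rho> * (sinh (a \<rho>) - a \<rho>)) \<longlongrightarrow> 0) at_top"
    unfolding a_def using x by real_asymp
  then have "((\<lambda>\<rho>. cos l * (\<rho> * (sinh (a \<rho>) - a \<rho>))) \<longlongrightarrow> cos l * 0) at_top"
    by (intro tendsto_intros)
  ultimately have expo:
      "((\<lambda>\<rho>. exp (Complex (- sin l * (\<rho> * (cosh (a \<rho>) - 1)) - x\<^sup>2 / (2 * \<tau>)) (cos l *
          (\<rho> * (sinh (a \<rho>) - a \<rho>)))))
      \<longlongrightarrow> exp (Complex (- sin l * (x\<^sup>2 / 2) - x\<^sup>2 / (2 * \<tau>)) (cos l * 0))) at_top"
    by (intro tendsto_exp tendsto_Complex)
  have "isCont sinh (\<i> * of_real l)"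
    by (intro DERIV_isCont[where D = "cosh (\<i> * of_real l)"]) (auto intro!: derivative_eq_intros)
  then have sinh: "((\<lambda>\<rho>. sinh (s \<rho>)) \<longlongrightarrow> sinh (\<i> * of_real l)) at_top"
    by (rule isCont_tendsto_compose[OF _ s])
  have sinh_l: "sinh (\<i> * of_real l) = \<i> * of_real (sin l)"
    by (simp add: complex_eq_iff Re_sinh Im_sinh)
  let ?G = "\<lambda>\<rho>. exp (Complex (- sin l * (\<rho> * (cosh (a \<rho>) - 1)) - x\<^sup>2 / (2 * \<tau>)) (cos l *
      (\<rho> * (sinh (a \<rho>) - a \<rho>)))) *
      (of_real (sqrt (z / \<rho>)) * sabr_kernel (s \<rho>) (z / \<rho>)) / sinh (s \<rho>) / of_real (sqrt z)"
  have "(?G \<longlongrightarrow> exp (Complex (- sin l * (x\<^sup>2 / 2) - x\<^sup>2 / (2 * \<tau>)) (cos l * 0)) *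
      of_real (sqrt q) / sinh (\<i> * of_real l) / of_real (sqrt z)) at_top"
    using z sin by (intro tendsto_divide tendsto_mult expo kernel sinh tendsto_const)
        (auto simp: sinh_l)
  then have
      "((\<lambda>\<rho>. Im (?G \<rho>)) \<longlongrightarrow> Im (exp (Complex (- sin l * (x\<^sup>2 / 2) - x\<^sup>2 / (2 * \<tau>)) (cos l * 0)) *
          of_real (sqrt q) / sinh (\<i> * of_real l) / of_real (sqrt z))) at_top"
    by (rule tendsto_Im)
  also have "Im (exp (Complex (- sin l * (x\<^sup>2 / 2) - x\<^sup>2 / (2 * \<tau>)) (cos l * 0)) *
      of_real (sqrt q) / sinh (\<i> * of_real l) / of_real (sqrt z)) =
      - (sqrt q / sin l) * (exp (- \<alpha> * x\<^sup>2) * (1 / sqrt z))"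
  proof -
    have "- sin l * (x\<^sup>2 / 2) - x\<^sup>2 / (2 * \<tau>) = - \<alpha> * x\<^sup>2"
      by (simp add: \<alpha>_def algebra_simps add_divide_distrib)
    moreover have "exp (Complex r 0) = of_real (exp r)" for r
      by (simp add: Complex_eq exp_of_real)
    ultimately show ?thesis
      unfolding sinh_l by (simp add: Im_divide_of_real Im_divide power2_eq_square)
  qed
  finally have lim: "((\<lambda>\<rho>. Im (?G \<rho>)) \<longlongrightarrow> - (sqrt q / sin l) * (exp (- \<alpha> * x\<^sup>2) * (1 / sqrt z)))
      at_top" .
  have "\<forall>\<^sub>F \<rho> in at_top. Im (?G \<rho>) = scaled_integrand \<tau> l \<rho> z x"
    using eventually_gt_at_top[of "0::real"]
  proof eventually_elim
    case (elim \<rho>)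
    have [simp]: "Re (s \<rho>) = a \<rho>" "Im (s \<rho>) = l" by (simp_all add: s_def)
    have a2: "\<rho> * (a \<rho>)\<^sup>2 = x\<^sup>2" using elim by (simp add: a_def power_divide)
    let ?T = "\<tau> / \<rho>"
    have Re: "Re ((s \<rho>)\<^sup>2) = (a \<rho>)\<^sup>2 - l\<^sup>2" and Im: "Im ((s \<rho>)\<^sup>2) = 2 * a \<rho> * l"
      by (simp_all add: power2_eq_square)
    have "of_real (\<rho> * (sin l - l\<^sup>2 / (2 * \<tau>))) +
        (\<i> * of_real \<rho> * sinh (s \<rho>) + - (s \<rho>)\<^sup>2 / of_real (2 * ?T)) =
        Complex (- sin l * (\<rho> * (cosh (a \<rho>) - 1)) - x\<^sup>2 / (2 * \<tau>)) (cos l *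
            (\<rho> * (sinh (a \<rho>) - a \<rho>)))"
    proof (rule complex_eqI)
      have "\<rho> * (sin l - l\<^sup>2 / (2 * \<tau>)) + (- \<rho> * (cosh (a \<rho>) * sin l) - ((a \<rho>)\<^sup>2 - l\<^sup>2) / (2 * ?T))
          =
          - sin l * (\<rho> * (cosh (a \<rho>) - 1)) - x\<^sup>2 / (2 * \<tau>)"
        unfolding a2[symmetric] using elim \<tau> by (simp add: field_simps)
      then show "Re (of_real (\<rho> * (sin l - l\<^sup>2 / (2 * \<tau>))) +
          (\<i> * of_real \<rho> * sinh (s \<rho>) + - (s \<rho>)\<^sup>2 / of_real (2 * ?T))) =
          Re (Complex (- sin l * (\<rho> * (cosh (a \<rho>) - 1)) - x\<^sup>2 / (2 * \<tau>)) (cos l *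
              (\<rho> * (sinh (a \<rho>) - a \<rho>))))"
        by (simp only: plus_complex.simps Re_divide_of_real uminus_complex.simps Re
            Re_complex_of_real complex.sel)
          (simp add: Im_sinh algebra_simps diff_divide_distrib)
      \<comment> \<open>Here the saddle point equation is used: l = \<tau> cos l cancels the part of
        the phase linear in \<open>a\<close>, which would otherwise be of order sqrt \<rho>.\<close>
      have "\<rho> * (sinh (a \<rho>) * cos l) - 2 * a \<rho> * l / (2 * ?T) = cos l * (\<rho> * (sinh (a \<rho>) - a \<rho>))"
        using elim \<tau> by (subst l(3)) (simp add: field_simps)
      then show "Im (of_real (\<rho> * (sin l - l\<^sup>2 / (2 * \<tau>))) +
          (\<i> * of_real \<rho> * sinh (s \<rho>) + - (s \<rho>)\<^sup>2 / of_real (2 * ?T))) =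
          Im (Complex (- sin l * (\<rho> * (cosh (a \<rho>) - 1)) - x\<^sup>2 / (2 * \<tau>)) (cos l *
              (\<rho> * (sinh (a \<rho>) - a \<rho>))))"
        by (simp only: plus_complex.simps Im_divide_of_real uminus_complex.simps Im
            Im_complex_of_real complex.sel)
          (simp add: Re_sinh)
    qed
    then have "?G \<rho> = exp (of_real (\<rho> * (sin l - l\<^sup>2 / (2 * \<tau>)))) *
        (exp (\<i> * of_real \<rho> * sinh (s \<rho>)) * exp (- (s \<rho>)\<^sup>2 / of_real (2 * ?T))) *
        (of_real (sqrt (z / \<rho>)) * sabr_kernel (s \<rho>) (z / \<rho>)) / sinh (s \<rho>) / of_real (sqrt z)"
      by (simp only: exp_add[symmetric])
    also have "\<dots> = of_real (exp (\<rho> * (sin l - l\<^sup>2 / (2 * \<tau>))) * (sqrt (z / \<rho>) / sqrt z)) *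
        shifted_integrand \<rho> ?T l (z / \<rho>) (a \<rho>)"
      unfolding shifted_integrand_def Let_def s_def[symmetric] exp_of_real
        of_real_mult[of "exp (\<rho> * (sin l - l\<^sup>2 / (2 * \<tau>)))"] of_real_divide[of "sqrt (z / \<rho>)"]
      by (simp only: times_divide_eq_left times_divide_eq_right divide_divide_eq_left mult_ac)
    also have "sqrt (z / \<rho>) / sqrt z = 1 / sqrt \<rho>"
      using z by (simp add: real_sqrt_divide)
    finally have "Im (?G \<rho>) = Im (of_real (exp (\<rho> * (sin l - l\<^sup>2 / (2 * \<tau>))) * (1 / sqrt \<rho>)) *
        shifted_integrand \<rho> ?T l (z / \<rho>) (a \<rho>))"
      by (rule arg_cong)
    then show ?case
      by (simp only: scaled_integrand_def a_def times_complex.simps Re_complex_of_real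
          Im_complex_of_real) simp
  qed
  from Lim_transform_eventually[OF lim this] show ?thesis unfolding q_def \<alpha>_def .
qed

lemma borel_measurable_scaled_integrand:
  assumes "0 < \<tau>" "0 < l" "l < pi / 2" "0 < \<rho>"
  shows "(\<lambda>(z, x). indicator {0<..} z * (indicator {0<..} x * scaled_integrand \<tau> l \<rho> z x)) \<in>
      borel_measurable (borel :: (real \<times> real) measure)"
proof -
  have "(\<lambda>p. (fst p / \<rho>, snd p / sqrt \<rho>)) \<in> borel_measurable (borel :: (real \<times> real) measure)"
    using assms by (intro borel_measurable_continuous_onI continuous_intros) auto
  from measurable_compose[OF this borel_measurable_shifted_integrand[of l "\<tau> / \<rho>" \<rho>]] assms
  have "(\<lambda>p. exp (\<rho> * (sin l - l\<^sup>2 / (2 * \<tau>))) / sqrt \<rho> *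
      (indicator {0<..} (fst p / \<rho>) * (indicator {0<..} (snd p / sqrt \<rho>) *
      Im (shifted_integrand \<rho> (\<tau> / \<rho>) l (fst p / \<rho>) (snd p / sqrt \<rho>))))) \<in> borel_measurable
          (borel :: (real \<times> real) measure)"
    by (intro borel_measurable_times[OF borel_measurable_const]) (simp add: case_prod_beta)
  also have "(\<lambda>p. exp (\<rho> * (sin l - l\<^sup>2 / (2 * \<tau>))) / sqrt \<rho> *
      (indicator {0<..} (fst p / \<rho>) * (indicator {0<..} (snd p / sqrt \<rho>) *
      Im (shifted_integrand \<rho> (\<tau> / \<rho>) l (fst p / \<rho>) (snd p / sqrt \<rho>))))) =
      (\<lambda>(z, x). indicator {0<..} z * (indicator {0<..} x * scaled_integrand \<tau> l \<rho> z x))"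
    using assms by (auto simp: fun_eq_iff scaled_integrand_def indicator_def zero_less_divide_iff)
  finally show ?thesis .
qed

text \<open>Dominated convergence twice, in \<open>x\<close> for each \<open>z\<close> and then in
  \<open>z\<close>. Strict positivity of \<open>K\<close> matters: the logarithm of the scaled
  integral has to stay bounded.\<close>

lemma scaled_integral_tendsto:
  assumes \<tau>: "0 < \<tau>" and l: "0 < l" "l < pi / 2" "l = \<tau> * cos l"
  obtains K where "0 < K"
    "((\<lambda>\<rho>. LBINT z:{0<..}. exp (- z / (2 * \<tau>)) * (LBINT x:{0<..}. scaled_integrand \<tau> l \<rho> z x)) \<longlongrightarrow>
        - K) at_top"
proof -
  define c where "c = sqrt (sin l / (2 * l)) / sin l"
  define \<alpha> where "\<alpha> = sin l / 2 + 1 / (2 * \<tau>)"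
  define C where "C = exp l / (sin l * sqrt (cos l))"
  define h where "h z x = - c * (exp (- \<alpha> * x\<^sup>2) * (1 / sqrt z))" for z x :: real
  \<comment> \<open>Cutting \<rho> off below at 1 makes measurability and the majorant hold for
    every \<rho>; the values for \<rho> \<ge> 1 are unchanged.\<close>
  define H where "H \<rho> z x = scaled_integrand \<tau> l (max 1 \<rho>) z x" for \<rho> z x
  define wx where "wx x = exp (x - x\<^sup>2 / (2 * \<tau>))" for x :: real
  define wz where "wz z = exp (sqrt z) / sqrt z" for z :: real
  have sin: "sin l > 0" using l by (intro sin_gt_zero) auto
  have cos: "cos l > 0" using l by (intro cos_gt_zero_pi) auto
  have c: "0 < c" using sin l by (simp add: c_def)
  have \<alpha>: "0 < \<alpha>" using sin \<tau> by (simp add: \<alpha>_def add_pos_pos)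
  have C: "0 < C" using sin cos by (simp add: C_def)
  have H_le: "\<bar>H \<rho> z x\<bar> \<le> C * (wx x * wz z)" if "0 < z" "0 < x" for \<rho> z x
    unfolding H_def C_def wx_def wz_def using that \<tau> l by (intro abs_scaled_integrand_le) auto
  have H_lim: "((\<lambda>\<rho>. H \<rho> z x) \<longlongrightarrow> h z x) at_top" if "0 < z" "0 < x" for z x
  proof (rule Lim_transform_eventually)
    show "((\<lambda>\<rho>. scaled_integrand \<tau> l \<rho> z x) \<longlongrightarrow> h z x) at_top"
      unfolding h_def c_def \<alpha>_def by (rule scaled_integrand_tendsto[OF \<tau> l that(2,1)])
    show "\<forall>\<^sub>F \<rho> in at_top. scaled_integrand \<tau> l \<rho> z x = H \<rho> z x"
      using eventually_ge_at_top[of "1::real"] by eventually_elim (simp add: H_def max_def)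
  qed
  have H_meas: "(\<lambda>(z, x). indicator {0<..} z * (indicator {0<..} x * H \<rho> z x)) \<in> borel_measurable
      (borel \<Otimes>\<^sub>M lborel)" for \<rho>
    unfolding H_def using borel_measurable_scaled_integrand[OF \<tau> l(1,2), of "max 1 \<rho>"]
    by (simp add: borel_prod[symmetric] cong: measurable_cong_sets)
  have H_meas': "(\<lambda>x. indicator {0<..} x * H \<rho> z x) \<in> borel_measurable lborel" if "0 < z" for \<rho> z
  proof -
    have "z \<in> space borel" by simp
    from measurable_Pair2[OF H_meas this] that show ?thesis by simp
  qed
  have int_wx: "set_integrable lborel {0<..} wx"
    unfolding wx_def by (rule set_integrable_exp_minus_square[OF \<tau>])
  have int_wz: "set_integrable lborel {0<..} (\<lambda>z. exp (- z / (2 * \<tau>)) * wz z)"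
    unfolding wz_def using set_integrable_exp_sqrt[of "1 / (2 * \<tau>)"] \<tau> by simp

  have inner: "((\<lambda>\<rho>. LBINT x:{0<..}. H \<rho> z x) \<longlongrightarrow> (LBINT x:{0<..}. h z x)) at_top" if z: "0 < z" for z
    unfolding set_lebesgue_integral_def
  proof (rule integral_dominated_convergence_at_top)
    show "integrable lborel (\<lambda>x. indicator {0<..} x *\<^sub>R (C * (wx x * wz z)))"
      using set_integrable_mult_right[OF set_integrable_mult_left[OF int_wx, of "wz z"], of C]
      by (simp add: set_integrable_def)
    show "(\<lambda>x. indicator {0<..} x *\<^sub>R H \<rho> z x) \<in> borel_measurable lborel" for \<rho>
      using H_meas'[OF z, of \<rho>] by simp
    show "(\<lambda>x. indicator {0<..} x *\<^sub>R h z x) \<in> borel_measurable lborel"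
      unfolding h_def by measurable
    show "AE x in lborel. ((\<lambda>\<rho>. indicator {0<..} x *\<^sub>R H \<rho> z x) \<longlongrightarrow> indicator {0<..} x *\<^sub>R h z x)
        at_top"
      using H_lim[OF z] by (intro AE_I2) (auto simp: indicator_def)
    show "\<forall>\<^sub>F \<rho> in at_top. AE x in lborel. norm (indicator {0<..} x *\<^sub>R H \<rho> z x) \<le>
        indicator {0<..} x *\<^sub>R (C * (wx x * wz z))"
      using H_le[OF z] by (intro always_eventually allI AE_I2) (auto simp: indicator_def)
  qed

  have inner_le: "\<bar>LBINT x:{0<..}. H \<rho> z x\<bar> \<le> C * (LBINT x:{0<..}. wx x) * wz z" if z: "0 < z"
      for \<rho> z
  proof -
    have g: "set_integrable lborel {0<..} (\<lambda>x. C * (wx x * wz z))"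
      by (intro set_integrable_mult_right set_integrable_mult_left int_wx)
    have f: "set_integrable lborel {0<..} (H \<rho> z)"
    proof (rule set_integrable_bound[OF g])
      show "set_borel_measurable lborel {0<..} (H \<rho> z)"
        using H_meas'[OF z, of \<rho>] by (simp add: set_borel_measurable_def)
      show "AE x in lborel. x \<in> {0<..} \<longrightarrow> norm (H \<rho> z x) \<le> norm (C * (wx x * wz z))"
        using H_le[OF z] by (intro AE_I2 impI) (simp add: order_trans[OF _ abs_ge_self])
    qed
    have "\<bar>LBINT x:{0<..}. H \<rho> z x\<bar> \<le> (LBINT x:{0<..}. \<bar>H \<rho> z x\<bar>)"
      using set_integral_norm_bound[OF f] by simp
    also have "\<dots> \<le> (LBINT x:{0<..}. C * (wx x * wz z))"
      using H_le[OF z] by (intro set_integral_mono g set_integrable_abs f) auto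
    finally show ?thesis
      unfolding set_integral_mult_right set_integral_mult_left by (simp only: mult.assoc)
  qed

  have outer: "((\<lambda>\<rho>. LBINT z:{0<..}. exp (- z / (2 * \<tau>)) * (LBINT x:{0<..}. H \<rho> z x)) \<longlongrightarrow>
      (LBINT z:{0<..}. exp (- z / (2 * \<tau>)) * (LBINT x:{0<..}. h z x))) at_top"
    unfolding set_lebesgue_integral_def[of lborel "{0<..}" "\<lambda>z. exp (- z / (2 * \<tau>)) * _ z"]
  proof (rule integral_dominated_convergence_at_top)
    let ?w = "\<lambda>z. C * (LBINT x:{0<..}. wx x) * (exp (- z / (2 * \<tau>)) * wz z)"
    show "integrable lborel (\<lambda>z. indicator {0<..} z *\<^sub>R ?w z)"
      using set_integrable_mult_right[OF int_wz, of "C * (LBINT x:{0<..}. wx x)"]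
      by (simp add: set_integrable_def)
    show "(\<lambda>z. indicator {0<..} z *\<^sub>R (exp (- z / (2 * \<tau>)) * (LBINT x:{0<..}. H \<rho> z x))) \<in>
        borel_measurable lborel" for \<rho>
    proof -
      have "(\<lambda>z. LBINT x. indicator {0<..} z * (indicator {0<..} x * H \<rho> z x)) \<in> borel_measurable
          borel"
        by (rule lborel.borel_measurable_lebesgue_integral[OF H_meas])
      then have "(\<lambda>z. exp (- z / (2 * \<tau>)) * (indicator {0<..} z *
          (LBINT x. indicator {0<..} x * H \<rho> z x))) \<in> borel_measurable borel"
        by simp
      then show ?thesis by (simp add: set_lebesgue_integral_def mult_ac)
    qed
    show "(\<lambda>z. indicator {0<..} z *\<^sub>R (exp (- z / (2 * \<tau>)) * (LBINT x:{0<..}. h z x))) \<in>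
        borel_measurable lborel"
      unfolding h_def set_integral_mult_right set_integral_mult_left by measurable
    show "AE z in lborel. ((\<lambda>\<rho>. indicator {0<..} z *\<^sub>R (exp (- z / (2 * \<tau>)) *
        (LBINT x:{0<..}. H \<rho> z x))) \<longlongrightarrow>
        indicator {0<..} z *\<^sub>R (exp (- z / (2 * \<tau>)) * (LBINT x:{0<..}. h z x))) at_top"
      using inner by (intro AE_I2) (auto simp: indicator_def intro!: tendsto_mult)
    show "\<forall>\<^sub>F \<rho> in at_top. AE z in lborel. norm
        (indicator {0<..} z *\<^sub>R (exp (- z / (2 * \<tau>)) * (LBINT x:{0<..}. H \<rho> z x))) \<le>
            indicator {0<..} z *\<^sub>R ?w z"
    proof (intro always_eventually allI AE_I2)
      fix \<rho> z :: real
      show "norm (indicator {0<..} z *\<^sub>R (exp (- z / (2 * \<tau>)) * (LBINT x:{0<..}. H \<rho> z x))) \<le>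
          indicator {0<..} z *\<^sub>R ?w z"
      proof (cases "0 < z")
        case True
        have "exp (- z / (2 * \<tau>)) * \<bar>LBINT x:{0<..}. H \<rho> z x\<bar> \<le> exp (- z / (2 * \<tau>)) *
            (C * (LBINT x:{0<..}. wx x) * wz z)"
          by (intro mult_left_mono inner_le True) auto
        with True show ?thesis by (simp add: abs_mult mult_ac)
      qed simp
    qed
  qed

  \<comment> \<open>The pointwise limit \<open>h\<close> is a product of a function of
    \<open>x\<close> and one of \<open>z\<close>, so its double integral factors.\<close>
  define K where "K = c * ((LBINT x:{0<..}. exp (- \<alpha> * x\<^sup>2)) *
      (LBINT z:{0<..}. exp (- z / (2 * \<tau>)) * (1 / sqrt z)))"
  have int_x: "set_integrable lborel {0<..} (\<lambda>x::real. exp (- \<alpha> * x\<^sup>2))"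
  \<comment> \<open>With T = 1 / (2\<alpha>) the majorant is exp (x - \<alpha> x^2), larger by the
    factor exp x \<ge> 1.\<close>
  proof (rule set_integrable_bound[OF set_integrable_exp_minus_square[of "1 / (2 * \<alpha>)"]])
    show "set_borel_measurable lborel {0<..} (\<lambda>x. exp (- \<alpha> * x\<^sup>2))"
      by (intro set_borel_measurable_lborel continuous_intros) auto
  qed (use \<alpha> in \<open>auto simp: mult_ac\<close>)
  have int_z: "set_integrable lborel {0<..} (\<lambda>z. exp (- z / (2 * \<tau>)) * (1 / sqrt z))"
  proof (rule set_integrable_bound[OF int_wz])
    show "set_borel_measurable lborel {0<..} (\<lambda>z. exp (- z / (2 * \<tau>)) * (1 / sqrt z))"
      using \<tau> by (intro set_borel_measurable_lborel continuous_intros) auto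
  qed (auto simp: wz_def divide_right_mono)
  have "0 < K"
    unfolding K_def using c
    by (intro mult_pos_pos set_integral_pos_greaterThan int_x int_z) auto
  moreover have "(LBINT z:{0<..}. exp (- z / (2 * \<tau>)) * (LBINT x:{0<..}. h z x)) = - K"
  proof -
    have "(LBINT z:{0<..}. exp (- z / (2 * \<tau>)) * (LBINT x:{0<..}. h z x)) =
        (LBINT z:{0<..}. - c * (LBINT x:{0<..}. exp (- \<alpha> * x\<^sup>2)) *
            (exp (- z / (2 * \<tau>)) * (1 / sqrt z)))"
    proof (intro set_lebesgue_integral_cong allI impI)
      fix z :: real
      have "(LBINT x:{0<..}. h z x) = - c * ((LBINT x:{0<..}. exp (- \<alpha> * x\<^sup>2)) * (1 / sqrt z))"
        unfolding h_def set_integral_mult_right set_integral_mult_left ..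
      then show "exp (- z / (2 * \<tau>)) * (LBINT x:{0<..}. h z x) =
          - c * (LBINT x:{0<..}. exp (- \<alpha> * x\<^sup>2)) * (exp (- z / (2 * \<tau>)) * (1 / sqrt z))"
        by (simp only: mult_ac)
    qed auto
    also have "\<dots> = - c * (LBINT x:{0<..}. exp (- \<alpha> * x\<^sup>2)) *
        (LBINT z:{0<..}. exp (- z / (2 * \<tau>)) * (1 / sqrt z))"
      by (rule set_integral_mult_right)
    also have "\<dots> = - K" by (simp add: K_def)
    finally show ?thesis .
  qed
  moreover have "\<forall>\<^sub>F \<rho> in at_top. (LBINT z:{0<..}. exp (- z / (2 * \<tau>)) * (LBINT x:{0<..}. H \<rho> z x))
      =
      (LBINT z:{0<..}. exp (- z / (2 * \<tau>)) * (LBINT x:{0<..}. scaled_integrand \<tau> l \<rho> z x))"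
    using eventually_ge_at_top[of "1::real"] by eventually_elim (simp add: H_def max_def)
  ultimately show thesis
    using that[of K] Lim_transform_eventually[OF outer] by simp
qed

section \<open>The decay rate as a variance and the logarithmic limit\<close>

lemma sabr_lambda:
  assumes "0 < \<tau>"
  shows "0 < sabr_lambda \<tau>" "sabr_lambda \<tau> < pi / 2" "sabr_lambda \<tau> / cos (sabr_lambda \<tau>) = \<tau>"
  using theI'[OF sabr_lambda_ex1[OF assms]] unfolding sabr_lambda_def by blast+

text \<open>By the double-angle formulas the variance is 2 sin l cos l / l - (cos l)^2; multiplied
  by \<tau> = l / cos l it becomes 2 sin l - l cos l, and l cos l = l^2 / \<tau>.\<close>

lemma Sigma_BS_hat_sq_eq:
  assumes "0 < \<tau>"
  defines "l \<equiv> sabr_lambda \<tau>"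
  shows "1 / 4 * Sigma_BS_hat_sq \<tau> * \<tau> = (sin l - l\<^sup>2 / (2 * \<tau>)) / 2"
proof -
  note l = sabr_lambda[OF assms(1), folded l_def]
  have cos: "0 < cos l" using l by (intro cos_gt_zero_pi) auto
  have "Sigma_BS_hat_sq \<tau> = 2 * sin l * cos l / l - (cos l)\<^sup>2"
    unfolding Sigma_BS_hat_sq_def l_def[symmetric] Let_def sin_double cos_double_cos by simp
  then have "1 / 4 * Sigma_BS_hat_sq \<tau> * (l / cos l) = (sin l - l\<^sup>2 / (2 * (l / cos l))) / 2"
    using cos l(1) by (simp add: field_simps power2_eq_square)
  then show ?thesis unfolding l(3) .
qed

text \<open>The remainder is exp (- \<rho> E) times a power of \<rho>, a factor tending to 1, and a
  factor with a positive limit. After division of the logarithm by 2\<rho> only - E / 2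
  survives.\<close>

lemma ln_sabr_remainder_tendsto:
  fixes S0 \<tau> :: real
  assumes S0: "0 < S0" and \<tau>: "0 < \<tau>"
  defines "l \<equiv> sabr_lambda \<tau>"
  shows "((\<lambda>\<rho>. 1 / (2 * \<rho>) * ln (S0 - sabr_atm_formula S0 (2 * \<rho>) (\<tau> / \<rho>))) \<longlongrightarrow>
    - ((sin l - l\<^sup>2 / (2 * \<tau>)) / 2)) at_top"
proof -
  note l = sabr_lambda[OF \<tau>, folded l_def]
  define E where "E = sin l - l\<^sup>2 / (2 * \<tau>)"
  define A where "A = 2 * S0 / pi powr (3 / 2)"
  define L where "L \<rho> = (LBINT z:{0<..}. exp (- z / (2 * \<tau>)) *
      (LBINT x:{0<..}. scaled_integrand \<tau> l \<rho> z x))" for \<rho>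
  have A: "0 < A" using S0 by (simp add: A_def)
  have "cos l > 0" using l by (intro cos_gt_zero_pi) auto
  then have "l = \<tau> * cos l" using l(3) by (simp add: field_simps)
  then obtain K where K: "0 < K" "(L \<longlongrightarrow> - K) at_top"
    using scaled_integral_tendsto[OF \<tau> l(1,2)] unfolding L_def by blast
  have "((\<lambda>\<rho>. 1 / (2 * \<rho>) * ln (- L \<rho>)) \<longlongrightarrow> 0 * ln (- (- K))) at_top"
  proof (intro tendsto_mult tendsto_ln tendsto_minus K)
    show "((\<lambda>\<rho>::real. 1 / (2 * \<rho>)) \<longlongrightarrow> 0) at_top" by real_asymp
  qed (use K in auto)
  moreover have "((\<lambda>\<rho>. 1 / (2 * \<rho>) * (ln A - \<tau> / (8 * \<rho>) - (ln \<tau> - ln \<rho>) / 2 - \<rho> * E - ln \<rho>)) \<longlongrightarrow>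
      - (E / 2)) at_top"
    by real_asymp
  ultimately have lim:
      "((\<lambda>\<rho>. 1 / (2 * \<rho>) * (ln A - \<tau> / (8 * \<rho>) - (ln \<tau> - ln \<rho>) / 2 - \<rho> * E - ln \<rho>) + 1 / (2 * \<rho>) *
          ln (- L \<rho>)) \<longlongrightarrow> - (E / 2) + 0 * ln (- (- K))) at_top"
    by (intro tendsto_add)
  have "\<forall>\<^sub>F \<rho> in at_top. L \<rho> < 0"
    using K by (intro order_tendstoD(2)[OF K(2)]) simp
  then have "\<forall>\<^sub>F \<rho> in at_top. 1 / (2 * \<rho>) * (ln A - \<tau> / (8 * \<rho>) - (ln \<tau> - ln \<rho>) / 2 - \<rho> * E - ln \<rho>)
      + 1 / (2 * \<rho>) * ln (- L \<rho>) =
      1 / (2 * \<rho>) * ln (S0 - sabr_atm_formula S0 (2 * \<rho>) (\<tau> / \<rho>))"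
    using eventually_gt_at_top[of "0::real"]
  proof eventually_elim
    case (elim \<rho>)
    have "sabr_atm_formula S0 (2 * \<rho>) (\<tau> / \<rho>) =
        S0 * (1 + 2 * exp (- (\<tau> / \<rho>) / 8) / (pi powr (3 / 2) * sqrt (\<tau> / \<rho>)) *
            (exp (- \<rho> * E) / \<rho> * L \<rho>))"
      unfolding L_def E_def using elim \<tau> l
      by (subst sabr_atm_formula_eq[of \<rho> l], simp_all only: shifted_integral_scaled) auto
    \<comment> \<open>The sign is moved into - L, which is eventually positive, so that the
      logarithm splits into a sum.\<close>
    then have eq: "S0 - sabr_atm_formula S0 (2 * \<rho>) (\<tau> / \<rho>) =
        A * (exp (- (\<tau> / \<rho>) / 8) / sqrt (\<tau> / \<rho>) * (exp (- \<rho> * E) / \<rho> * (- L \<rho>)))"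
      by (simp add: A_def algebra_simps)
    have ln: "ln (A * (exp a / R * (exp b / \<rho> * N))) = ln A + a - ln R + b - ln \<rho> + ln N"
      if "0 < R" "0 < N" for a b R N
      using that A elim by (simp add: ln_mult_pos ln_div)
    have sqrt: "ln (sqrt (\<tau> / \<rho>)) = (ln \<tau> - ln \<rho>) / 2"
      using elim \<tau> by (simp add: ln_sqrt ln_div)
    have "ln (S0 - sabr_atm_formula S0 (2 * \<rho>) (\<tau> / \<rho>)) =
        ln A + - (\<tau> / \<rho>) / 8 - ln (sqrt (\<tau> / \<rho>)) + - \<rho> * E - ln \<rho> + ln (- L \<rho>)"
      unfolding eq using elim \<tau> by (intro ln) auto
    then have "ln (S0 - sabr_atm_formula S0 (2 * \<rho>) (\<tau> / \<rho>)) =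
        ln A - \<tau> / (8 * \<rho>) - (ln \<tau> - ln \<rho>) / 2 - \<rho> * E - ln \<rho> + ln (- L \<rho>)"
      unfolding sqrt by (simp add: mult.commute)
    then show ?case by (simp add: distrib_left)
  qed
  from Lim_transform_eventually[OF lim this] show ?thesis by (simp add: E_def)
qed

theorem proposition1:
  fixes S0 \<tau> :: real
    and M :: "real \<Rightarrow> 'a measure"
    and F :: "real \<Rightarrow> real \<Rightarrow> 'a measure"
    and W Z S \<sigma> :: "real \<Rightarrow> real \<Rightarrow> 'a \<Rightarrow> real"
    and C :: "real \<Rightarrow> real \<Rightarrow> real"
  assumes S0: "S0 > 0"
    and tau: "\<tau> > 0"
    and model: "\<And>\<sigma>0. \<sigma>0 > 0 \<Longrightarrow>
      sabr_model (M \<sigma>0) (F \<sigma>0) (W \<sigma>0) (Z \<sigma>0) S0 \<sigma>0 (S \<sigma>0) (\<sigma> \<sigma>0)"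
    and price: "\<And>\<sigma>0 T. \<sigma>0 > 0 \<Longrightarrow> T > 0 \<Longrightarrow> C \<sigma>0 T = call_price (M \<sigma>0) (S \<sigma>0) S0 T"
    and representation: "\<And>\<sigma>0 T. \<sigma>0 > 0 \<Longrightarrow> T > 0 \<Longrightarrow> C \<sigma>0 T = sabr_atm_formula S0 \<sigma>0 T"
  shows "((\<lambda>\<sigma>0. 1 / \<sigma>0 * ln (S0 - C \<sigma>0 (2 * \<tau> / \<sigma>0))) \<longlongrightarrow>
           - (1 / 4) * Sigma_BS_hat_sq \<tau> * \<tau>) at_top"
proof (rule Lim_transform_eventually)
  \<comment> \<open>With \<rho> = \<sigma>0 / 2 the maturity 2\<tau> / \<sigma>0 is \<tau>/\<rho>,
    and the normalisation 1 / (2\<rho>) is 1 / \<sigma>0.\<close>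
  have "filterlim (\<lambda>\<sigma>0::real. \<sigma>0 / 2) at_top at_top" by real_asymp
  from filterlim_compose[OF ln_sabr_remainder_tendsto[OF S0 tau] this]
  show "((\<lambda>\<sigma>0. 1 / (2 * (\<sigma>0 / 2)) * ln (S0 - sabr_atm_formula S0 (2 * (\<sigma>0 / 2)) (\<tau> / (\<sigma>0 / 2)))) \<longlongrightarrow>
      - (1 / 4) * Sigma_BS_hat_sq \<tau> * \<tau>) at_top"
    unfolding Sigma_BS_hat_sq_eq[OF tau, symmetric] by (simp only: mult_minus_left)
  show "\<forall>\<^sub>F \<sigma>0 in at_top. 1 / (2 * (\<sigma>0 / 2)) *
      ln (S0 - sabr_atm_formula S0 (2 * (\<sigma>0 / 2)) (\<tau> / (\<sigma>0 / 2))) =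
      1 / \<sigma>0 * ln (S0 - C \<sigma>0 (2 * \<tau> / \<sigma>0))"
    using eventually_gt_at_top[of "0::real"]
    by eventually_elim (use tau in \<open>simp add: representation mult.commute\<close>)
qed

end
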